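(* Let $p$ be a prime and $n\ge1$. Let $L$ be an irreducible representation of $Y(\mathfrak{gl}_n)$ over $\overline{\mathbb{F}}_p$ which, as a $\mathfrak{gl}_n$-representation (via $E_{ij}\mapsto t_{ij}^{(1)}$), is isomorphic to $V(\mu^{(1)},p)\oplus\dots\oplus V(\mu^{(k)},p)$ with dominant integral weights $\mu^{(j)}$, where $p>\max_j(\mu^{(j)}_1-\mu^{(j)}_n)+n$, and let $\lambda(u)=(\lambda_1(u),\dots,\lambda_n(u))$ be such that $L\cong L(\lambda(u),p)$. Then there are monic polynomials $P_1(u),\dots,P_{n-1}(u)\in\overline{\mathbb{F}}_p[u]$ such that $\frac{\lambda_i(u)}{\lambda_{i+1}(u)}=\frac{P_i(u+1)}{P_i(u)}$ for $i=1,\dots,n-1$.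
   Context: $Y(\mathfrak{gl}_n)$ over $\overline{\mathbb{F}}_p$ is generated by $t_{ij}^{(r)}$, $1\le i,j\le n$, $r\ge1$, with relations $[t_{ij}^{(r+1)},t_{kl}^{(s)}]-[t_{ij}^{(r)},t_{kl}^{(s+1)}]=t_{kj}^{(r)}t_{il}^{(s)}-t_{kj}^{(s)}t_{il}^{(r)}$, $t_{ij}^{(0)}=\delta_{ij}$; $t_{ij}(u)=\delta_{ij}+\sum_{r\ge1}t_{ij}^{(r)}u^{-r}$. For $\lambda_i(u)\in1+u^{-1}\overline{\mathbb{F}}_p[[u^{-1}]]$, $L(\lambda(u),p)$ is the irreducible quotient of the Verma module generated by $\xi$ with $t_{ij}(u)\xi=0$ for $i<j$ and $t_{ii}(u)\xi=\lambda_i(u)\xi$. For a dominant integral weight $\mu$, the Weyl module $V(\mu,p)$ is the quotient of the $\mathfrak{gl}_n$-Verma module $M(\mu,p)$ with highest weight vector $v$ by the submodule generated by $f_i^{\mu_i-\mu_{i+1}+1}v$, $1\le i\le n-1$. *)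

theory Defs
  imports "HOL-Computational_Algebra.Computational_Algebra" "HOL-Library.Function_Algebras"
begin

definition lin_on :: "('k::field \<Rightarrow> 'v::ab_group_add \<Rightarrow> 'v) \<Rightarrow> ('k \<Rightarrow> 'w::ab_group_add \<Rightarrow> 'w)
    \<Rightarrow> 'v set \<Rightarrow> ('v \<Rightarrow> 'w) \<Rightarrow> bool" where
  "lin_on sc sc' U f \<longleftrightarrow>
     (\<forall>x\<in>U. \<forall>y\<in>U. f (x + y) = f x + f y) \<and> (\<forall>c. \<forall>x\<in>U. f (sc c x) = sc' c (f x))"

definition ksubspace :: "('k::field \<Rightarrow> 'v::ab_group_add \<Rightarrow> 'v) \<Rightarrow> 'v set \<Rightarrow> bool" where
  "ksubspace sc U \<longleftrightarrow> 0 \<in> U \<and> (\<forall>x\<in>U. \<forall>y\<in>U. x + y \<in> U) \<and> (\<forall>c. \<forall>x\<in>U. sc c x \<in> U)"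

definition fsc :: "'k::field \<Rightarrow> (nat \<Rightarrow> 'k) \<Rightarrow> (nat \<Rightarrow> 'k)" where
  "fsc c x = (\<lambda>i. c * x i)"

definition tgen :: "(nat \<Rightarrow> nat \<Rightarrow> nat \<Rightarrow> 'v \<Rightarrow> 'v) \<Rightarrow> nat \<Rightarrow> nat \<Rightarrow> nat \<Rightarrow> 'v::ab_group_add \<Rightarrow> 'v" where
  "tgen T i j r = (if r = 0 then (if i = j then id else (\<lambda>_. 0)) else T i j r)"

definition yangian_rep :: "('k::field \<Rightarrow> 'v::ab_group_add \<Rightarrow> 'v) \<Rightarrow> nat
    \<Rightarrow> (nat \<Rightarrow> nat \<Rightarrow> nat \<Rightarrow> 'v \<Rightarrow> 'v) \<Rightarrow> bool" where
  "yangian_rep sc n T \<longleftrightarrow> vector_space sc \<and>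
     (\<forall>i\<in>{1..n}. \<forall>j\<in>{1..n}. \<forall>r\<ge>1. lin_on sc sc UNIV (T i j r)) \<and>
     (\<forall>i\<in>{1..n}. \<forall>j\<in>{1..n}. \<forall>k\<in>{1..n}. \<forall>l\<in>{1..n}. \<forall>r s x.
        (tgen T i j (r+1) (tgen T k l s x) - tgen T k l s (tgen T i j (r+1) x))
        - (tgen T i j r (tgen T k l (s+1) x) - tgen T k l (s+1) (tgen T i j r x))
        = tgen T k j r (tgen T i l s x) - tgen T k j s (tgen T i l r x))"

definition yangian_irreducible :: "('k::field \<Rightarrow> 'v::ab_group_add \<Rightarrow> 'v) \<Rightarrow> nat
    \<Rightarrow> (nat \<Rightarrow> nat \<Rightarrow> nat \<Rightarrow> 'v \<Rightarrow> 'v) \<Rightarrow> bool" where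
  "yangian_irreducible sc n T \<longleftrightarrow> (\<exists>x::'v. x \<noteq> 0) \<and>
     (\<forall>U. ksubspace sc U \<and> (\<forall>i\<in>{1..n}. \<forall>j\<in>{1..n}. \<forall>r\<ge>1. T i j r ` U \<subseteq> U)
          \<longrightarrow> U = {0} \<or> U = UNIV)"

text \<open>The irreducible Yangian module contains a highest weight vector of highest weight
  lam (lam i r = coefficient of u^(-r) in lambda_i(u)); for irreducible modules this is
  exactly the condition of being isomorphic to L(lambda(u),p).\<close>
definition yangian_highest_weight :: "('k::field \<Rightarrow> 'v::ab_group_add \<Rightarrow> 'v) \<Rightarrow> nat
    \<Rightarrow> (nat \<Rightarrow> nat \<Rightarrow> nat \<Rightarrow> 'v \<Rightarrow> 'v) \<Rightarrow> (nat \<Rightarrow> nat \<Rightarrow> 'k) \<Rightarrow> bool" where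
  "yangian_highest_weight sc n T lam \<longleftrightarrow> (\<exists>\<xi>. \<xi> \<noteq> 0 \<and>
     (\<forall>i\<in>{1..n}. \<forall>j\<in>{1..n}. \<forall>r\<ge>1. i < j \<longrightarrow> T i j r \<xi> = 0) \<and>
     (\<forall>i\<in>{1..n}. \<forall>r\<ge>1. T i i r \<xi> = sc (lam i r) \<xi>))"

definition gl_module :: "('k::field \<Rightarrow> 'w::ab_group_add \<Rightarrow> 'w) \<Rightarrow> nat
    \<Rightarrow> (nat \<Rightarrow> nat \<Rightarrow> 'w \<Rightarrow> 'w) \<Rightarrow> 'w set \<Rightarrow> bool" where
  "gl_module sc n E U \<longleftrightarrow> ksubspace sc U \<and>
     (\<forall>a\<in>{1..n}. \<forall>b\<in>{1..n}. E a b ` U \<subseteq> U \<and> lin_on sc sc U (E a b)) \<and>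
     (\<forall>a\<in>{1..n}. \<forall>b\<in>{1..n}. \<forall>c\<in>{1..n}. \<forall>d\<in>{1..n}. \<forall>x\<in>U.
        E a b (E c d x) - E c d (E a b x)
        = (if b = c then E a d x else 0) - (if d = a then E c b x else 0))"

definition dominant :: "nat \<Rightarrow> (nat \<Rightarrow> int) \<Rightarrow> bool" where
  "dominant n \<mu> \<longleftrightarrow> (\<forall>i\<in>{1..<n}. \<mu> (i+1) \<le> \<mu> i)"

definition weyl_rel :: "('k::field \<Rightarrow> 'w::ab_group_add \<Rightarrow> 'w) \<Rightarrow> nat
    \<Rightarrow> (nat \<Rightarrow> nat \<Rightarrow> 'w \<Rightarrow> 'w) \<Rightarrow> (nat \<Rightarrow> int) \<Rightarrow> 'w \<Rightarrow> bool" where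
  "weyl_rel sc n E \<mu> v \<longleftrightarrow>
     (\<forall>a\<in>{1..n}. \<forall>b\<in>{1..n}. a < b \<longrightarrow> E a b v = 0) \<and>
     (\<forall>a\<in>{1..n}. E a a v = sc (of_int (\<mu> a)) v) \<and>
     (\<forall>i\<in>{1..<n}. (E (i+1) i ^^ nat (\<mu> i - \<mu> (i+1) + 1)) v = 0)"

definition cyclic_sub :: "('k::field \<Rightarrow> 'w::ab_group_add \<Rightarrow> 'w) \<Rightarrow> nat
    \<Rightarrow> (nat \<Rightarrow> nat \<Rightarrow> 'w \<Rightarrow> 'w) \<Rightarrow> 'w \<Rightarrow> 'w set" where
  "cyclic_sub sc n E v = \<Inter>{U. ksubspace sc U \<and> v \<in> U \<and> (\<forall>a\<in>{1..n}. \<forall>b\<in>{1..n}. E a b ` U \<subseteq> U)}"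

text \<open>W (a submodule of the gl_n-module given by E) is isomorphic to the Weyl module V(mu,p):
  W is generated by a vector v satisfying the defining relations, and is universal with this
  property, i.e. it is the gl_n-module presented by these relations (the quotient of the Verma
  module M(mu,p) by the submodule generated by the f_i^(mu_i-mu_(i+1)+1) v). Universality is
  tested against all gl_n-modules realised on subspaces of nat => K; this suffices since the
  presented module has countable dimension.\<close>
definition is_weyl_module :: "('k::field \<Rightarrow> 'v::ab_group_add \<Rightarrow> 'v) \<Rightarrow> nat
    \<Rightarrow> (nat \<Rightarrow> nat \<Rightarrow> 'v \<Rightarrow> 'v) \<Rightarrow> 'v set \<Rightarrow> (nat \<Rightarrow> int) \<Rightarrow> bool" where
  "is_weyl_module sc n E W \<mu> \<longleftrightarrow> gl_module sc n E W \<and>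
     (\<exists>v\<in>W. W = cyclic_sub sc n E v \<and> weyl_rel sc n E \<mu> v \<and>
        (\<forall>(U :: (nat \<Rightarrow> 'k) set) B v'. gl_module fsc n B U \<and> v' \<in> U \<and> weyl_rel fsc n B \<mu> v'
           \<longrightarrow> (\<exists>\<phi>. lin_on sc fsc W \<phi> \<and> \<phi> ` W \<subseteq> U \<and> \<phi> v = v' \<and>
                  (\<forall>a\<in>{1..n}. \<forall>b\<in>{1..n}. \<forall>w\<in>W. \<phi> (E a b w) = B a b (\<phi> w)))))"

end

theory Submission
  imports Defs
begin

text \<open>Fix \<open>i\<close> and write \<open>a, b, c, d\<close> for the currents \<open>t\<^sub>i\<^sub>i, t\<^sub>i\<^sub>j, t\<^sub>j\<^sub>i, t\<^sub>j\<^sub>j\<close> with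
  \<open>j = i + 1\<close>, and \<open>f = c\<^sub>1\<close>. In a Weyl module with \<open>\<mu>\<^sub>1 - \<mu>\<^sub>n < p - n\<close> all coordinates of weights lie
  between \<open>\<mu>\<^sub>n\<close> and \<open>\<mu>\<^sub>1\<close>, so \<open>L\<close> is finite dimensional and \<open>f\<^bsup>p-1\<^esup> = 0\<close> on \<open>L\<close>. Finite
  dimension makes \<open>\<lambda>\<^sub>i / \<lambda>\<^sub>j\<close> a rational function \<open>A / B\<close>, and after rescaling the series all
  currents act by polynomials on the vectors generated from the highest weight vector \<open>\<xi>\<close>. The last
  nonzero \<open>f\<^bsup>k\<^esup>\<xi>\<close> has \<open>k < p - 1\<close>, and \<open>a(u)\<close> acts on it by the eigenvalue of \<open>d(u)\<close> on \<open>\<xi>\<close>.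
  Since \<open>c(u) a(u - 1) = a(u) c(u - 1)\<close>, the product \<open>a(u) a(u - 1) \<dots> a(u - p + 1)\<close> commutes with
  \<open>f\<close> in characteristic \<open>p\<close>. Comparing its eigenvalues on \<open>\<xi>\<close> and \<open>f\<^bsup>k\<^esup>\<xi>\<close> shows that \<open>A\<close> and \<open>B\<close> have the
  same norm for the shift \<open>u \<mapsto> u + 1\<close> of order \<open>p\<close>, and Hilbert 90 provides \<open>P\<close>.\<close>

section \<open>Polynomials and the shift of order p\<close>

lemma pcompose_shift_linear: "pcompose [:b, 1:] [:c, 1:] = [:b + c, 1 :: 'a::comm_ring_1:]"
  by (simp add: pcompose_pCons)

text \<open>Over a finite field \<open>Q\<close> vanishes everywhere, so \<open>Q + 1\<close> would
  have no root.\<close>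

lemma infinite_UNIV_if_roots:
  assumes "\<forall>P :: 'a::field poly. degree P \<ge> 1 \<longrightarrow> (\<exists>x. poly P x = 0)"
  shows "infinite (UNIV :: 'a set)"
proof
  assume fin: "finite (UNIV :: 'a set)"
  define Q :: "'a poly" where "Q = (\<Prod>a\<in>UNIV. [:-a, 1:])"
  have "degree Q = card (UNIV :: 'a set)"
    unfolding Q_def by (subst degree_prod_eq_sum_degree) auto
  then have "degree Q \<ge> 1"
    using fin by (simp add: Suc_le_eq card_gt_0_iff)
  moreover have "degree (Q + 1) = degree Q"
    using calculation by (intro degree_add_eq_left) simp
  ultimately obtain x where "poly (Q + 1) x = 0"
    using assms by metis
  moreover have "poly Q x = 0"
    unfolding Q_def poly_prod by (rule prod_zero[OF fin]) (auto intro: bexI[of _ x])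
  ultimately show False
    by simp
qed

lemma poly_eq_if_infinite:
  fixes P Q :: "'a::idom poly"
  assumes "infinite (UNIV :: 'a set)" "\<And>u. poly P u = poly Q u"
  shows "P = Q"
  using poly_roots_finite[of "P - Q"] assms by auto

text \<open>The product telescopes: the shift moves the window of factors by one, trading
  \<open>u - b\<close> for \<open>u + m - b\<close>. This treats two linear factors whose roots
  differ by an integer.\<close>

lemma shift_ratio_linear:
  fixes b :: "'a::idom"
  shows "\<exists>P. lead_coeff P = 1 \<and> [:of_nat m - b, 1:] * P = [:-b, 1:] * pcompose P [:1, 1:]"
proof (intro exI conjI)
  let ?P = "\<Prod>i<m. [:of_nat i - b, 1:]"
  show "lead_coeff ?P = 1"
    by (simp add: lead_coeff_prod)
  have "[:-b, 1:] * pcompose ?P [:1, 1:] = (\<Prod>i<Suc m. [:of_nat i - b, 1:])"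
    by (simp add: pcompose_prod pcompose_shift_linear prod.lessThan_Suc_shift algebra_simps
        del: prod.lessThan_Suc)
  also have "\<dots> = [:of_nat m - b, 1:] * ?P"
    by (simp add: mult.commute)
  finally show "[:of_nat m - b, 1:] * ?P = [:-b, 1:] * pcompose ?P [:1, 1:]" ..
qed

text \<open>The roots fill a full orbit of the shift. Moving \<open>a\<close> by one trades the
  factor \<open>i = 0\<close> for \<open>i = p\<close>, and these agree in characteristic
  \<open>p\<close>.\<close>

lemma prod_shifts_linear_periodic:
  fixes a :: "'a::idom"
  assumes "of_nat p = (0 :: 'a)"
  shows "(\<Prod>i<p. [:- (a + of_nat m) - of_nat i, 1:]) = (\<Prod>i<p. [:- a - of_nat i, 1:])"
proof (induction m)
  case (Suc m)
  let ?b = "a + of_nat m"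
  have "[:- ?b, 1:] * (\<Prod>i<p. [:- (a + of_nat (Suc m)) - of_nat i, 1:])
      = (\<Prod>i<Suc p. [:- ?b - of_nat i, 1:])"
    unfolding prod.lessThan_Suc_shift
    by (intro arg_cong2[where f = times] prod.cong) (simp_all add: algebra_simps)
  also have "\<dots> = [:- ?b, 1:] * (\<Prod>i<p. [:- ?b - of_nat i, 1:])"
    using assms by (simp add: mult.commute)
  finally have "(\<Prod>i<p. [:- (a + of_nat (Suc m)) - of_nat i, 1:]) = (\<Prod>i<p. [:- ?b - of_nat i, 1:])"
    by (rule mult_left_cancel[THEN iffD1, rotated]) simp
  then show ?case
    using Suc.IH by simp
qed simp

text \<open>Hilbert 90 for the shift \<open>u \<mapsto> u + 1\<close>, which has order \<open>p\<close> in characteristic \<open>p\<close>.\<close>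

lemma shift_ratio_if_norms_eq:
  fixes A B :: "'a::field poly"
  assumes closed: "\<forall>P :: 'a poly. degree P \<ge> 1 \<longrightarrow> (\<exists>x. poly P x = 0)"
    and p: "of_nat p = (0 :: 'a)" "p > 0"
    and "lead_coeff A = 1" "lead_coeff B = 1"
    and "(\<Prod>j<p. pcompose A [:- of_nat j, 1:]) = (\<Prod>j<p. pcompose B [:- of_nat j, 1:])"
  shows "\<exists>P. lead_coeff P = 1 \<and> A * P = B * pcompose P [:1, 1:]"
  using assms(4-)
proof (induction "degree A" arbitrary: A B)
  case 0
  have A: "A = 1"
    using 0(1,2) by (metis degree_eq_zeroE lead_coeff_pCons(2) one_pCons)
  have "degree B = 0"
  proof (rule ccontr)
    assume "degree B \<noteq> 0"
    then obtain x where "poly B x = 0"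
      using closed by (metis One_nat_def Suc_leI neq0_conv)
    then have "poly (\<Prod>j<p. pcompose B [:- of_nat j, 1:]) x = 0"
      using p(2) by (auto simp: poly_prod poly_pcompose intro!: prod_zero bexI[of _ 0])
    then have "poly (\<Prod>j<p. pcompose A [:- of_nat j, 1:]) x = 0"
      by (simp only: 0(4))
    then show False
      by (simp add: A pcompose_1)
  qed
  then have "B = 1"
    using 0(3) by (metis degree_eq_zeroE lead_coeff_pCons(2) one_pCons)
  then show ?case
    using A by (intro exI[of _ 1]) (simp add: pcompose_1)
next
  case (Suc d)
  obtain a where a: "poly A a = 0"
    using closed Suc(2) by (metis le_add1 plus_1_eq_Suc)
  \<comment> \<open>The factor \<open>j = 0\<close> makes \<open>a\<close> a root of the norm of
    \<open>A\<close>, hence of that of \<open>B\<close>, so \<open>B\<close> vanishes at some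
    \<open>a - j\<close>. Roots are thus paired off along orbits.\<close>
  have "poly (\<Prod>j<p. pcompose A [:- of_nat j, 1:]) a = 0"
    using p(2) a by (auto simp: poly_prod poly_pcompose intro!: prod_zero bexI[of _ 0])
  then have "poly (\<Prod>j<p. pcompose B [:- of_nat j, 1:]) a = 0"
    by (simp only: Suc(5))
  then obtain j where "poly B (a - of_nat j) = 0"
    by (auto simp: poly_prod poly_pcompose)
  then obtain b where b: "poly B b = 0" "a = b + of_nat j"
    by (metis diff_add_cancel)
  obtain A' B' where A': "A = [:-a, 1:] * A'" and B': "B = [:-b, 1:] * B'"
    using a b(1) by (meson poly_eq_0_iff_dvd dvdE)
  have lead: "lead_coeff A' = 1" "lead_coeff B' = 1"
    using Suc(3,4) unfolding A' B' by (simp_all only: lead_coeff_mult) simp_all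
  have "A' \<noteq> 0"
    using lead by auto
  then have "degree A' = d"
    using Suc(2) unfolding A' by (subst (asm) degree_mult_eq) auto
  moreover have "(\<Prod>i<p. pcompose A' [:- of_nat i, 1:]) = (\<Prod>i<p. pcompose B' [:- of_nat i, 1:])"
  proof -
    have split: "(\<Prod>i<p. pcompose ([:-c, 1:] * C) [:- of_nat i, 1:])
        = (\<Prod>i<p. [:- c - of_nat i, 1:]) * (\<Prod>i<p. pcompose C [:- of_nat i, 1:])"
      for c and C :: "'a poly"
      by (simp add: pcompose_mult pcompose_shift_linear prod.distrib del: mult_pCons_left)
    have "(\<Prod>i<p. [:- a - of_nat i, 1:]) = (\<Prod>i<p. [:- b - of_nat i, 1:])"
      using prod_shifts_linear_periodic[OF p(1), of b j] b(2) by simp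
    moreover have "(\<Prod>i<p. [:- b - of_nat i, 1:]) \<noteq> 0"
      by simp
    ultimately show ?thesis
      using Suc(5) unfolding A' B' split by (metis mult_left_cancel)
  qed
  ultimately obtain P where P: "lead_coeff P = 1" "A' * P = B' * pcompose P [:1, 1:]"
    using Suc(1) lead by blast
  \<comment> \<open>\<open>shift_ratio_linear\<close> takes natural shifts only;
    \<open>(p - 1) * j\<close> stands for \<open>-j\<close>, which leads from \<open>b\<close> to
    \<open>a = b + j\<close>.\<close>
  have "of_nat ((p - 1) * j) = - (of_nat j :: 'a)"
    using p by (simp add: of_nat_diff algebra_simps)
  then have "[:of_nat ((p - 1) * j) - b, 1:] = [:-a, 1:]"
    using b(2) by simp
  then obtain R where R: "lead_coeff R = 1" "[:-a, 1:] * R = [:-b, 1:] * pcompose R [:1, 1:]"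
    using shift_ratio_linear[of "(p - 1) * j" b] by metis
  show ?case
  proof (intro exI conjI)
    show "lead_coeff (P * R) = 1"
      using P(1) R(1) by (simp only: lead_coeff_mult) simp
    have "A * (P * R) = (A' * P) * ([:-a, 1:] * R)"
      unfolding A' by (simp only: ac_simps)
    also have "\<dots> = B * pcompose (P * R) [:1, 1:]"
      unfolding P(2) R(2) B' pcompose_mult by (simp only: ac_simps)
    finally show "A * (P * R) = B * pcompose (P * R) [:1, 1:]" .
  qed
qed

text \<open>\<open>A\<close> is \<open>u^D F\<close> with the variable of \<open>F\<close> read as
  \<open>u^-1\<close>. Its degree is exactly \<open>D\<close> because \<open>F $ 0 = 1\<close>
  becomes the leading coefficient.\<close>

lemma fps_eq_reflect_poly:
  fixes F :: "'a::field fps"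
  assumes "F $ 0 = 1" "\<And>N. N > D \<Longrightarrow> F $ N = 0"
  obtains A where "lead_coeff A = 1" "degree A = D" "fps_of_poly (reflect_poly A) = F"
proof -
  define A where "A = (\<Sum>s\<le>D. monom (F $ (D - s)) s)"
  have cA: "coeff A s = (if s \<le> D then F $ (D - s) else 0)" for s
    unfolding A_def by (simp add: coeff_sum coeff_monom)
  have dA: "degree A = D"
    by (intro antisym degree_le le_degree) (auto simp: cA assms)
  show thesis
    by (rule that[of A]) (auto simp: dA cA assms fps_eq_iff coeff_reflect_poly)
qed

lemma poly_eq_sum_reflect:
  fixes A :: "'a::field poly"
  shows "poly A u = (\<Sum>N\<le>degree A. fps_of_poly (reflect_poly A) $ N * u ^ (degree A - N))"
  unfolding poly_altdef
  by (rule sum.reindex_bij_witness[of _ "\<lambda>N. degree A - N" "\<lambda>N. degree A - N"])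
     (auto simp: coeff_reflect_poly)

section \<open>Weights of Weyl modules\<close>

locale gl_rep = vector_space sc for sc :: "'k::field \<Rightarrow> 'v::ab_group_add \<Rightarrow> 'v" +
  fixes n :: nat and E :: "nat \<Rightarrow> nat \<Rightarrow> 'v \<Rightarrow> 'v"
  assumes lin: "\<lbrakk>a \<in> {1..n}; b \<in> {1..n}\<rbrakk> \<Longrightarrow> Vector_Spaces.linear sc sc (E a b)"
    and comm: "\<lbrakk>a \<in> {1..n}; b \<in> {1..n}; c \<in> {1..n}; d \<in> {1..n}\<rbrakk> \<Longrightarrow>
      E a b (E c d x) - E c d (E a b x)
      = (if b = c then E a d x else 0) - (if d = a then E c b x else 0)"
begin

lemma
  assumes "a \<in> {1..n}" "b \<in> {1..n}"
  shows E_add: "E a b (x + y) = E a b x + E a b y"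
    and E_scale: "E a b (sc r x) = sc r (E a b x)"
    and E_zero: "E a b 0 = 0"
    and E_neg: "E a b (- x) = - E a b x"
  using lin[OF assms] by (auto simp: linear_iff_module_hom intro: module_hom.add module_hom.scale
      module_hom.zero module_hom.neg)

lemma E_commute:
  assumes "a \<in> {1..n}" "b \<in> {1..n}" "c \<in> {1..n}" "d \<in> {1..n}" "b \<noteq> c" "d \<noteq> a"
  shows "E a b (E c d x) = E c d (E a b x)"
  using comm[OF assms(1-4), of x] assms(5,6) by simp

lemma funpow_E_zero: "\<lbrakk>a \<in> {1..n}; b \<in> {1..n}\<rbrakk> \<Longrightarrow> (E a b ^^ m) 0 = 0"
  by (induction m) (simp_all add: E_zero)

section \<open>Words of lowering operators in one column\<close>

abbreviation E_word :: "nat \<Rightarrow> nat list \<Rightarrow> 'v \<Rightarrow> 'v" where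
  "E_word i bs \<equiv> foldr (\<lambda>b. E b i) bs"

lemma E_word_zero:
  assumes "i \<in> {1..n}" "set bs \<subseteq> {i<..n}"
  shows "E_word i bs 0 = 0"
  using assms by (induction bs) (auto simp: E_zero)

lemma E_word_add:
  assumes "i \<in> {1..n}" "set bs \<subseteq> {i<..n}"
  shows "E_word i bs (x + y) = E_word i bs x + E_word i bs y"
  using assms by (induction bs) (auto simp: E_add)

lemma E_word_scale:
  assumes "i \<in> {1..n}" "set bs \<subseteq> {i<..n}"
  shows "E_word i bs (sc r x) = sc r (E_word i bs x)"
  using assms by (induction bs) (auto simp: E_scale)

lemma E_word_commute:
  assumes "i \<in> {1..n}" "set bs \<subseteq> {i<..n}" "a \<in> {1..n}" "b \<in> {1..n}" "a \<noteq> i" "b \<notin> set bs"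
  shows "E_word i bs (E a b x) = E a b (E_word i bs x)"
  using assms
proof (induction bs)
  case (Cons c bs)
  then show ?case
    using E_commute[of c i a b "E_word i bs x"] by auto
qed simp

text \<open>\<open>y\<close> is the commutator of \<open>g\<close> and \<open>x\<close> and commutes
  with both, so moving \<open>g\<close> through \<open>x ^^ a\<close> turns each of the
  \<open>a\<close> factors \<open>x\<close> into \<open>y\<close> once.\<close>

lemma heisenberg_word:
  assumes x: "Vector_Spaces.linear sc sc x" and y: "Vector_Spaces.linear sc sc y"
    and gx: "\<And>z. g (x z) = x (g z) + y z"
    and yx: "\<And>z. y (x z) = x (y z)" and gy: "\<And>z. g (y z) = y (g z)"
  shows "g ((x ^^ a) ((y ^^ b) z)) = (x ^^ a) ((y ^^ b) (g z)) + sc (of_nat a) ((x ^^ (a - 1)) ((y ^^ Suc b) z))"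
proof (induction a)
  case 0
  show ?case
    by (induction b) (simp_all add: gy)
next
  case (Suc a)
  interpret x: module_hom sc sc x using x by (simp add: linear_iff_module_hom)
  have yxa: "y ((x ^^ a) z) = (x ^^ a) (y z)" for z
    by (induction a arbitrary: z) (simp_all add: yx)
  have "sc (of_nat a) (x ((x ^^ (a - 1)) ((y ^^ Suc b) z))) = sc (of_nat a) ((x ^^ a) ((y ^^ Suc b) z))"
    by (cases a) simp_all
  then show ?case
    by (simp add: gx Suc.IH x.add x.scale yxa scale_left_distrib algebra_simps)
qed

text \<open>Passing from \<open>v\<close> to \<open>g v\<close> lowers \<open>M\<close> and raises \<open>N\<close>, and \<open>g\<close> moves exponents from
  \<open>x\<close> to \<open>y\<close>.\<close>

lemma heisenberg_vanish:
  assumes x: "Vector_Spaces.linear sc sc x" and y: "Vector_Spaces.linear sc sc y"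
    and g0: "g 0 = 0"
    and gx: "\<And>z. g (x z) = x (g z) + y z"
    and yx: "\<And>z. y (x z) = x (y z)" and gy: "\<And>z. g (y z) = y (g z)"
    and char: "\<And>m. \<lbrakk>0 < m; m \<le> S\<rbrakk> \<Longrightarrow> of_nat m \<noteq> (0 :: 'k)"
    and "(x ^^ N) v = 0" "(g ^^ M) v = 0" "N + M = Suc S" "N > 0" "b \<le> S"
  shows "(x ^^ (S - b)) ((y ^^ b) v) = 0"
  using assms(8-)
proof (induction M arbitrary: N v b)
  interpret x: module_hom sc sc x using x by (simp add: linear_iff_module_hom)
  interpret y: module_hom sc sc y using y by (simp add: linear_iff_module_hom)
  have x0: "(x ^^ a) 0 = 0" for a by (induction a) simp_all
  have y0: "(y ^^ a) 0 = 0" for a by (induction a) simp_all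
  case 0
  then show ?case by (simp add: x0 y0)
next
  interpret x: module_hom sc sc x using x by (simp add: linear_iff_module_hom)
  interpret y: module_hom sc sc y using y by (simp add: linear_iff_module_hom)
  have x0: "(x ^^ a) 0 = 0" for a by (induction a) simp_all
  have y0: "(y ^^ a) 0 = 0" for a by (induction a) simp_all
  have xay: "(x ^^ a) (y z) = y ((x ^^ a) z)" for a z
    by (induction a) (simp_all add: yx)
  note hw = heisenberg_word[OF x y gx yx gy]
  case (Suc M)
  \<comment> \<open>The exponent \<open>N + 1\<close> absorbs the commutator term, a multiple of
    \<open>(x ^^ N) (y v) = y ((x ^^ N) v) = 0\<close>.\<close>
  have "(x ^^ Suc N) (g v) = 0"
    using hw[of "Suc N" 0 v] Suc.prems(1) by (simp add: xay g0)
  moreover have "(g ^^ M) (g v) = 0"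
    using Suc.prems(2) by (simp add: funpow_swap1)
  ultimately have gv: "(x ^^ (S - b)) ((y ^^ b) (g v)) = 0" if "b \<le> S" for b
    using Suc.IH[of "Suc N" "g v" b] Suc.prems that by simp
  show ?case
    using \<open>b \<le> S\<close>
  proof (induction b)
    case 0
    have "S = (S - N) + N" using Suc.prems by simp
    then show ?case
      using Suc.prems(1) x0 by (metis comp_apply diff_zero funpow_0 funpow_add)
  next
    case (Suc b)
    \<comment> \<open>Apply \<open>g\<close> to the vector already known to vanish for
      \<open>b\<close>: the part with \<open>g v\<close> is zero by the outer induction, and the
      rest has one more \<open>y\<close> and the invertible factor \<open>S - b\<close>.\<close>
    have "sc (of_nat (S - b)) ((x ^^ (S - b - 1)) ((y ^^ Suc b) v)) = 0"
      using hw[of "S - b" b v] gv[of b] Suc by (simp add: g0)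
    moreover have "of_nat (S - b) \<noteq> (0 :: 'k)"
      using Suc.prems by (intro char) auto
    ultimately show ?case
      by simp
  qed
qed

text \<open>The diagonal operators see weights only modulo \<open>p\<close>. An integral lower bound
  for coordinate \<open>i\<close> is therefore encoded by how many letters \<open>E c i\<close> with
  \<open>c > i\<close> are certain to annihilate the vector.\<close>

definition kills :: "nat \<Rightarrow> nat \<Rightarrow> 'v \<Rightarrow> bool" where
  "kills i N x \<longleftrightarrow> (\<forall>bs. set bs \<subseteq> {i<..n} \<longrightarrow> length bs = N \<longrightarrow> E_word i bs x = 0)"

lemma kills_0_iff [simp]: "kills i 0 x \<longleftrightarrow> x = 0"
  by (auto simp: kills_def)

lemma kills_Suc: "kills i (Suc N) x \<longleftrightarrow> (\<forall>c\<in>{i<..n}. kills i N (E c i x))"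
proof safe
  fix c assume "kills i (Suc N) x" "c \<in> {i<..n}"
  then show "kills i N (E c i x)"
    unfolding kills_def
  proof (intro allI impI)
    fix bs assume "set bs \<subseteq> {i<..n}" "length bs = N"
    then show "E_word i bs (E c i x) = 0"
      using \<open>kills i (Suc N) x\<close> \<open>c \<in> {i<..n}\<close>
      by (auto simp: kills_def dest!: spec[of _ "bs @ [c]"])
  qed
next
  assume *: "\<forall>c\<in>{i<..n}. kills i N (E c i x)"
  show "kills i (Suc N) x"
    unfolding kills_def
  proof (intro allI impI)
    fix bs assume bs: "set bs \<subseteq> {i<..n}" "length bs = Suc N"
    then obtain cs c where "bs = cs @ [c]"
      by (metis length_Suc_conv_rev)
    then show "E_word i bs x = 0"
      using * bs by (auto simp: kills_def)
  qed
qed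

lemma kills_zero: "i \<in> {1..n} \<Longrightarrow> kills i N 0"
  by (simp add: kills_def E_word_zero)

lemma kills_add: "\<lbrakk>i \<in> {1..n}; kills i N x; kills i N y\<rbrakk> \<Longrightarrow> kills i N (x + y)"
  by (simp add: kills_def E_word_add)

lemma kills_diff: "\<lbrakk>i \<in> {1..n}; kills i N x; kills i N y\<rbrakk> \<Longrightarrow> kills i N (x - y)"
  using E_word_add[of i _ x "- y"] E_word_scale[of i _ "-1" y] by (simp add: kills_def)

lemma kills_E_commute:
  assumes "i \<in> {1..n}" "a \<in> {1..n}" "b \<in> {1..n}" "a \<noteq> i" "b \<le> i" "kills i N x"
  shows "kills i N (E a b x)"
  using assms E_word_commute[of i _ a b x] by (fastforce simp: kills_def E_zero)

text \<open>The commutator of \<open>E c i\<close> with \<open>E a b\<close> is zero or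
  \<open>- E a i\<close>, again a letter of column \<open>i\<close>, so word lengths are
  preserved.\<close>

lemma kills_E_right:
  assumes "i \<in> {1..n}" "a \<in> {1..n}" "b \<in> {1..n}" "i < b" "i < a" "kills i N x"
  shows "kills i N (E a b x)"
  using assms(6)
proof (induction N arbitrary: x)
  case 0
  then show ?case using assms by (simp add: E_zero)
next
  case (Suc N)
  have "kills i N (E c i (E a b x))" if c: "c \<in> {i<..n}" for c
  proof -
    have "E c i (E a b x) = E a b (E c i x) - (if b = c then E a i x else 0)"
      using comm[of c i a b x] assms c by (auto simp: algebra_simps split: if_splits)
    moreover have "kills i N (E a b (E c i x))"
      using Suc c by (simp add: kills_Suc)
    moreover have "kills i N (E a i x)"
      using Suc.prems assms by (simp add: kills_Suc)
    ultimately show ?thesis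
      using assms by (auto intro: kills_diff)
  qed
  then show ?case
    by (simp add: kills_Suc)
qed

text \<open>The commutator of \<open>E c i\<close> with \<open>E i b\<close> is
  \<open>E c b\<close>, which commutes with all letters of column \<open>i\<close>; passing it uses
  up a single extra letter.\<close>

lemma kills_E_column:
  assumes "i \<in> {1..n}" "b \<in> {1..n}" "b < i" "kills i N x"
  shows "kills i (Suc N) (E i b x)"
  using assms(4)
proof (induction N arbitrary: x)
  case 0
  then show ?case using assms by (simp add: E_zero kills_zero)
next
  case (Suc N)
  have "kills i (Suc N) (E c i (E i b x))" if c: "c \<in> {i<..n}" for c
  proof -
    have "E c i (E i b x) = E i b (E c i x) + E c b x"
      using comm[of c i i b x] assms c by (auto simp: algebra_simps)
    moreover have "kills i (Suc N) (E i b (E c i x))"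
      using Suc c by (simp add: kills_Suc)
    moreover have "kills i (Suc N) (E c b x)"
      using Suc.prems assms c by (intro kills_E_commute) auto
    ultimately show ?thesis
      using assms by (auto intro: kills_add)
  qed
  then show ?case
    by (subst kills_Suc) auto
qed

end

section \<open>Weight bounds and finite dimension of highest weight modules\<close>

locale gl_hw = gl_rep +
  fixes \<mu> :: "nat \<Rightarrow> int" and v :: 'b
  assumes n_pos: "n \<ge> 1"
    and raise_v: "\<lbrakk>a \<in> {1..n}; b \<in> {1..n}; a < b\<rbrakk> \<Longrightarrow> E a b v = 0"
    and diag_v: "a \<in> {1..n} \<Longrightarrow> E a a v = sc (of_int (\<mu> a)) v"
    and lower_v: "i \<in> {1..<n} \<Longrightarrow> (E (i+1) i ^^ nat (\<mu> i - \<mu> (i+1) + 1)) v = 0"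
    and dominant: "i \<in> {1..<n} \<Longrightarrow> \<mu> (i+1) \<le> \<mu> i"
    and char: "\<lbrakk>0 < m; int m \<le> \<mu> 1 - \<mu> n + 1\<rbrakk> \<Longrightarrow> of_nat m \<noteq> (0 :: 'a)"
begin

lemma \<mu>_antimono:
  assumes "1 \<le> i" "i \<le> j" "j \<le> n"
  shows "\<mu> j \<le> \<mu> i"
  using assms(2,3)
proof (induction j rule: dec_induct)
  case (step j)
  then show ?case using dominant[of j] assms(1) by simp
qed simp

text \<open>Extends the relations from simple roots to all roots: \<open>E (m+1) i\<close> is the
  commutator of \<open>E (m+1) m\<close> and \<open>E m i\<close>, and the exponents of these two
  add up to \<open>S + 1\<close>, as \<open>heisenberg_vanish\<close> requires.\<close>

lemma E_column_power_v:
  assumes "1 \<le> i" "i < m" "m \<le> n"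
  shows "(E m i ^^ nat (\<mu> i - \<mu> m + 1)) v = 0"
  using Suc_leI[OF assms(2)] assms(3)
proof (induction m rule: dec_induct)
  case base
  then show ?case using lower_v[of i] assms by simp
next
  case (step m)
  define N M where "N = nat (\<mu> i - \<mu> m + 1)" and "M = nat (\<mu> m - \<mu> (m+1) + 1)"
  define S where "S = nat (\<mu> i - \<mu> (m+1) + 1)"
  have le: "\<mu> m \<le> \<mu> i" "\<mu> (m+1) \<le> \<mu> m" "\<mu> i \<le> \<mu> 1" "\<mu> n \<le> \<mu> (m+1)"
    using step.hyps step.prems assms by (auto intro!: \<mu>_antimono)
  have in_n: "i \<in> {1..n}" "m \<in> {1..n}" "Suc m \<in> {1..n}"
    using step.hyps step.prems assms by auto
  \<comment> \<open>The instance \<open>b = S\<close> leaves no factor \<open>E m i\<close>.\<close>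
  have "(E m i ^^ (S - S)) ((E (Suc m) i ^^ S) v) = 0"
  proof (rule heisenberg_vanish[where g = "E (Suc m) m" and N = N and M = M])
    show "E (Suc m) m (E m i z) = E m i (E (Suc m) m z) + E (Suc m) i z" for z
      using comm[of "Suc m" m m i z] in_n step.hyps by (auto simp: algebra_simps)
    show "E (Suc m) i (E m i z) = E m i (E (Suc m) i z)" for z
      using in_n step.hyps by (intro E_commute) auto
    show "E (Suc m) m (E (Suc m) i z) = E (Suc m) i (E (Suc m) m z)" for z
      using in_n step.hyps by (intro E_commute) auto
    show "(E m i ^^ N) v = 0"
      using step by (simp add: N_def)
    show "(E (Suc m) m ^^ M) v = 0"
      using lower_v[of m] in_n by (simp add: M_def)
    show "of_nat q \<noteq> (0 :: 'a)" if "0 < q" "q \<le> S" for q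
      using that le by (intro char) (auto simp: S_def)
  qed (use in_n le in \<open>auto intro: lin simp: E_zero N_def M_def S_def\<close>)
  then show ?case
    by (simp add: S_def)
qed

text \<open>The word \<open>E n i ^^ N\<close> kills \<open>v\<close>. The operators
  \<open>E c n\<close>, which kill \<open>v\<close> too, convert its letters one at a time into
  \<open>E c i\<close>, and this yields every word of length \<open>N\<close>.\<close>

lemma kills_v:
  assumes i: "i \<in> {1..n}"
  shows "kills i (nat (\<mu> i - \<mu> n + 1)) v"
proof (cases "i = n")
  case True
  then show ?thesis by (auto simp: kills_Suc)
next
  case False
  define N where "N = nat (\<mu> i - \<mu> n + 1)"
  have n: "i < n" "n \<in> {1..n}" "i \<in> {1..n}"
    using i False by auto
  have le: "\<mu> i \<le> \<mu> 1" "\<mu> n \<le> \<mu> i"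
    using i by (auto intro!: \<mu>_antimono)
  have raise: "E c n ((E n i ^^ m) v) = sc (of_nat m) (E c i ((E n i ^^ (m - 1)) v))"
    if c: "c \<in> {i<..<n}" for c m
  proof (induction m)
    case 0
    then show ?case using raise_v[of c n] c i by simp
  next
    case (Suc m)
    have "E c n (E n i ((E n i ^^ m) v)) = E n i (E c n ((E n i ^^ m) v)) + E c i ((E n i ^^ m) v)"
      using comm[of c n n i "(E n i ^^ m) v"] n c by (auto simp: algebra_simps)
    moreover have "E n i (E c i z) = E c i (E n i z)" for z
      using n c by (intro E_commute) auto
    moreover have "sc (of_nat m) (E c i (E n i ((E n i ^^ (m - 1)) v))) = sc (of_nat m) (E c i ((E n i ^^ m) v))"
      by (cases m) simp_all
    ultimately show ?case
      using n c by (simp add: Suc.IH E_scale scale_left_distrib add.commute)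
  qed
  \<comment> \<open>Each new letter \<open>c\<close> comes from applying \<open>E c n\<close>, at
    the price of the scalar \<open>m\<close>, the number of letters \<open>E n i\<close> still
    present. It is invertible since \<open>m \<le> N \<le> \<mu> 1 - \<mu> n + 1\<close>.\<close>
  have small: "E_word i bs ((E n i ^^ (N - length bs)) v) = 0"
    if "set bs \<subseteq> {i<..<n}" "length bs \<le> N" for bs
    using that
  proof (induction bs rule: rev_induct)
    case Nil
    then show ?case using E_column_power_v[of i n] n by (simp add: N_def)
  next
    case (snoc c bs)
    define m where "m = N - length bs"
    have c: "c \<in> {i<..<n}" and bs: "set bs \<subseteq> {i<..n}" "n \<notin> set bs"
      using snoc.prems by auto
    have "0 = E c n (E_word i bs ((E n i ^^ m) v))"
      using snoc c n by (simp add: m_def E_zero)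
    also have "\<dots> = E_word i bs (E c n ((E n i ^^ m) v))"
      using bs c n by (intro E_word_commute[symmetric]) auto
    also have "\<dots> = sc (of_nat m) (E_word i bs (E c i ((E n i ^^ (m - 1)) v)))"
      using bs n by (simp add: raise[OF c] E_word_scale)
    finally have "sc (of_nat m) (E_word i bs (E c i ((E n i ^^ (m - 1)) v))) = 0" ..
    moreover have "of_nat m \<noteq> (0 :: 'a)"
      using snoc.prems le by (intro char) (auto simp: m_def N_def)
    ultimately show ?case
      by (simp add: m_def)
  qed
  \<comment> \<open>Letters of one column commute, so all letters \<open>n\<close> can be moved to
    the right end, which is the form treated in \<open>small\<close>.\<close>
  have sort: "E_word i bs z = E_word i (filter (\<lambda>b. b \<noteq> n) bs) ((E n i ^^ (length bs - length (filter (\<lambda>b. b \<noteq> n) bs))) z)"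
    if "set bs \<subseteq> {i<..n}" for bs z
    using that
  proof (induction bs)
    case (Cons c bs)
    let ?fs = "filter (\<lambda>b. b \<noteq> n) bs"
    show ?case
    proof (cases "c = n")
      case True
      have "E n i (E_word i ?fs y) = E_word i ?fs (E n i y)" for y
        using Cons.prems n by (intro E_word_commute[symmetric]) auto
      moreover have "length ?fs \<le> length bs" by simp
      ultimately show ?thesis
        using Cons True by (simp add: Suc_diff_le)
    qed (use Cons in simp)
  qed simp
  show ?thesis
    unfolding kills_def
  proof (intro allI impI)
    fix bs assume bs: "set bs \<subseteq> {i<..n}" "length bs = nat (\<mu> i - \<mu> n + 1)"
    let ?fs = "filter (\<lambda>b. b \<noteq> n) bs"
    have "set ?fs \<subseteq> {i<..<n}"
      using bs by auto
    moreover have "length ?fs \<le> N"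
      using bs by (auto simp: N_def length_filter_le intro: order_trans[OF length_filter_le])
    ultimately show "E_word i bs v = 0"
      using sort[OF bs(1), of v] small[of ?fs] bs by (simp add: N_def)
  qed
qed

text \<open>Lowering words applied to \<open>v\<close>, with an integral weight \<open>\<nu>\<close>
  and the length \<open>l\<close> kept as formal bookkeeping, because the operators determine
  weights only modulo \<open>p\<close>.\<close>

inductive reach :: "(nat \<Rightarrow> int) \<Rightarrow> nat \<Rightarrow> 'b \<Rightarrow> bool" where
  reach_v: "reach \<mu> 0 v"
| reach_E: "\<lbrakk>reach \<nu> l x; a \<in> {1..n}; b \<in> {1..n}; b < a\<rbrakk> \<Longrightarrow>
    reach (\<nu>(a := \<nu> a + 1, b := \<nu> b - 1)) (Suc l) (E a b x)"

text \<open>The letter count follows coordinate \<open>i\<close>: a step with \<open>b = i\<close>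
  uses up one letter, a step with \<open>a = i\<close> costs one more, and other steps leave the
  count alone.\<close>

lemma kills_reach:
  assumes "reach \<nu> l x" "i \<in> {1..n}"
  shows "kills i (nat (\<nu> i - \<mu> n + 1)) x"
  using assms(1)
proof induction
  case reach_v
  then show ?case using kills_v assms by simp
next
  case (reach_E \<nu> l x a b)
  define N where "N = nat (\<nu> i - \<mu> n + 1)"
  consider "b = i" | "a = i" | "i < b" | "b < i" "a \<noteq> i"
    by linarith
  then show ?case
  proof cases
    case 1
    \<comment> \<open>\<open>N = 0\<close> is separated because \<open>nat\<close> may have
      truncated there; in that case \<open>x = 0\<close>.\<close>
    show ?thesis
    proof (cases N)
      case 0
      then have "x = 0" using reach_E.IH by (simp add: N_def)
      then show ?thesis using reach_E assms by (simp add: E_zero kills_zero)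
    next
      case (Suc N')
      then have "kills i N' (E a i x)"
        using reach_E 1 by (auto simp: N_def kills_Suc)
      moreover have "N' = nat (\<nu> i - 1 - \<mu> n + 1)"
        using Suc by (simp add: N_def)
      ultimately show ?thesis
        using 1 by simp
    qed
  next
    case 2
    show ?thesis
    proof (cases N)
      case 0
      then have "x = 0" using reach_E.IH by (simp add: N_def)
      then show ?thesis using reach_E assms by (simp add: E_zero kills_zero)
    next
      case (Suc N')
      then have "nat (\<nu> i + 1 - \<mu> n + 1) = Suc N"
        by (simp add: N_def)
      then show ?thesis
        using 2 reach_E assms kills_E_column[of i b N x] by (simp add: N_def)
    qed
  next
    case 3
    then show ?thesis
      using reach_E assms kills_E_right[of i a b N x] by (auto simp: N_def)
  next
    case 4
    then show ?thesis
      using reach_E assms kills_E_commute[of i a b N x] by (auto simp: N_def)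
  qed
qed

lemma reach_ge:
  assumes "reach \<nu> l x" "x \<noteq> 0" "i \<in> {1..n}"
  shows "\<mu> n \<le> \<nu> i"
  using kills_reach[OF assms(1,3)] assms(2) by (cases "\<nu> i < \<mu> n") auto

abbreviation reachable :: "'b set" where
  "reachable \<equiv> {x. \<exists>\<nu> l. reach \<nu> l x}"

lemma lower_span_reachable:
  assumes "x \<in> span reachable" "a \<in> {1..n}" "b \<in> {1..n}" "b < a"
  shows "E a b x \<in> span reachable"
  using assms(1)
proof (induction rule: span_induct_alt)
  case base
  then show ?case using assms by (simp add: E_zero span_zero)
next
  case (step c x y)
  then show ?case
    using assms reach_E[of _ _ x a b]
    by (simp add: E_add E_scale) (blast intro: span_add span_scale span_base)
qed

text \<open>\<open>E a b\<close> is moved inward past the outermost lowering operator; both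
  commutator terms act on the shorter word, where the induction applies.\<close>

lemma E_reach_span:
  assumes "reach \<nu> l x" "a \<in> {1..n}" "b \<in> {1..n}"
  shows "E a b x \<in> span reachable"
  using assms
proof (induction arbitrary: a b)
  case reach_v
  consider "a < b" | "a = b" | "b < a" by linarith
  then show ?case
  proof cases
    case 1
    then show ?thesis using raise_v reach_v by (simp add: span_zero)
  next
    case 2
    then show ?thesis using diag_v[of b] reach_v(2) reach.reach_v by (auto intro!: span_scale intro: span_base)
  next
    case 3
    then show ?thesis using reach_E[OF reach.reach_v] reach_v by (auto intro!: span_base)
  qed
next
  case (reach_E \<nu> l x c d)
  have "E a b (E c d x) = E c d (E a b x) + ((if b = c then E a d x else 0) - (if d = a then E c b x else 0))"
    using comm[of a b c d x] reach_E by (simp add: algebra_simps split: if_splits)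
  also have "\<dots> \<in> span reachable"
    using reach_E lower_span_reachable by (auto intro!: span_add span_diff span_zero)
  finally show ?case .
qed

lemma cyclic_sub_subset_span: "cyclic_sub sc n E v \<subseteq> span reachable"
proof -
  have "E a b x \<in> span reachable" if "x \<in> span reachable" "a \<in> {1..n}" "b \<in> {1..n}" for a b x
    using that(1)
  proof (induction rule: span_induct_alt)
    case base
    then show ?case using that by (simp add: E_zero span_zero)
  next
    case (step c x y)
    then show ?case
      using that E_reach_span by (auto simp: E_add E_scale intro!: span_add span_scale)
  qed
  moreover have "v \<in> span reachable"
    using reach_v by (auto intro!: span_base)
  moreover have "ksubspace sc (span reachable)"
    by (auto simp: ksubspace_def intro: span_zero span_add span_scale)
  ultimately show ?thesis
    unfolding cyclic_sub_def by blast
qed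

text \<open>The diagram automorphism, which turns the lower bound for weights into the upper bound.\<close>

lemma gl_hw_mirror:
  "gl_hw sc n (\<lambda>a b x. - E (n + 1 - b) (n + 1 - a) x) (\<lambda>a. - \<mu> (n + 1 - a)) v"
proof (intro gl_hw.intro gl_rep.intro gl_rep_axioms.intro gl_hw_axioms.intro)
  show "vector_space sc" ..
  let ?E = "\<lambda>a b x. - E (n + 1 - b) (n + 1 - a) x"
  have mir: "n + 1 - a \<in> {1..n}" if "a \<in> {1..n}" for a
    using that by auto
  fix a b assume ab: "a \<in> {1..n}" "b \<in> {1..n}"
  note m = mir[OF ab(1)] mir[OF ab(2)]
  show "Vector_Spaces.linear sc sc (?E a b)"
    using vector_space_axioms m
    by (simp add: Vector_Spaces.linear_iff E_add E_scale del: One_nat_def)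
  show "?E a b (?E c d x) - ?E c d (?E a b x)
      = (if b = c then ?E a d x else 0) - (if d = a then ?E c b x else 0)"
    if cd: "c \<in> {1..n}" "d \<in> {1..n}" for c d x
  proof -
    note m' = mir[OF cd(1)] mir[OF cd(2)]
    have "n + 1 - a = n + 1 - d \<longleftrightarrow> d = a" "n + 1 - c = n + 1 - b \<longleftrightarrow> b = c"
      using ab cd by auto
    then show ?thesis
      using comm[OF m(2,1) m'(2,1), of x] unfolding E_neg[OF m(2,1)] E_neg[OF m'(2,1)]
      by (simp split: if_splits)
  qed
  show "?E a b v = 0" if "a < b"
    using raise_v[OF m(2,1)] that ab by simp
next
  fix a assume a: "a \<in> {1..n}"
  then have "n + 1 - a \<in> {1..n}" by auto
  then show "- E (n + 1 - a) (n + 1 - a) v = sc (of_int (- \<mu> (n + 1 - a))) v"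
    using diag_v by simp
next
  fix i assume i: "i \<in> {1..<n}"
  then have n: "n - i \<in> {1..<n}" "n + 1 - i = Suc (n - i)" "n + 1 - (i + 1) = n - i"
    by auto
  let ?f = "E (Suc (n - i)) (n - i)" and ?N = "nat (\<mu> (n - i) - \<mu> (Suc (n - i)) + 1)"
  have "((\<lambda>x. - ?f x) ^^ N) v = (?f ^^ N) v \<or> ((\<lambda>x. - ?f x) ^^ N) v = - (?f ^^ N) v" for N
    using n(1) i by (induction N) (auto simp: E_neg)
  from this[of ?N] have "((\<lambda>x. - ?f x) ^^ ?N) v = 0"
    using lower_v[OF n(1)] by simp
  moreover have "- \<mu> (Suc (n - i)) - - \<mu> (n - i) + 1 = \<mu> (n - i) - \<mu> (Suc (n - i)) + 1"
    by simp
  ultimately show "((\<lambda>x. - E (n + 1 - i) (n + 1 - (i + 1)) x) ^^ nat (- \<mu> (n + 1 - i) - - \<mu> (n + 1 - (i + 1)) + 1)) v = 0"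
    unfolding n(2,3) by (simp only:)
  show "- \<mu> (n + 1 - (i + 1)) \<le> - \<mu> (n + 1 - i)"
    using dominant[OF n(1)] unfolding n(2,3) by simp
next
  show "1 \<le> n" by (rule n_pos)
  show "of_nat m \<noteq> (0 :: 'a)" if "0 < m" "int m \<le> - \<mu> (n + 1 - 1) - - \<mu> (n + 1 - n) + 1" for m
    using that by (intro char) auto
qed

text \<open>This is \<open>reach_ge\<close> for the mirrored module. Its operators carry a sign, so
  a vector is reached there only up to sign.\<close>

lemma reach_le:
  assumes "reach \<nu> l x" "x \<noteq> 0" "i \<in> {1..n}"
  shows "\<nu> i \<le> \<mu> 1"
proof -
  define E' where "E' = (\<lambda>a b x. - E (n + 1 - b) (n + 1 - a) x)"
  interpret m: gl_hw sc n E' "\<lambda>a. - \<mu> (n + 1 - a)" v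
    unfolding E'_def by (rule gl_hw_mirror)
  have "\<exists>y\<in>{x, - x}. m.reach (\<lambda>a. - \<nu> (n + 1 - a)) l y"
    using assms(1)
  proof induction
    case reach_v
    then show ?case using m.reach_v by blast
  next
    case (reach_E \<nu> l x a b)
    let ?\<nu> = "\<lambda>a. - \<nu> (n + 1 - a)" and ?a = "n + 1 - a" and ?b = "n + 1 - b"
    obtain y where y: "y \<in> {x, - x}" "m.reach ?\<nu> l y"
      using reach_E.IH by blast
    have "m.reach (?\<nu>(?b := ?\<nu> ?b + 1, ?a := ?\<nu> ?a - 1)) (Suc l) (E' ?b ?a y)"
      using y(2) by (rule m.reach_E) (use reach_E in auto)
    moreover have "?\<nu>(?b := ?\<nu> ?b + 1, ?a := ?\<nu> ?a - 1)
        = (\<lambda>c. - (\<nu>(a := \<nu> a + 1, b := \<nu> b - 1)) (n + 1 - c))"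
      using reach_E.hyps by (intro ext) (auto simp: fun_upd_def)
    moreover have "E' ?b ?a y \<in> {E a b x, - E a b x}"
      using y(1) reach_E.hyps by (auto simp: E'_def E_neg)
    ultimately show ?case
      by metis
  qed
  then obtain y where y: "y \<in> {x, - x}" "m.reach (\<lambda>a. - \<nu> (n + 1 - a)) l y"
    by blast
  then have "- \<mu> (n + 1 - n) \<le> - \<nu> (n + 1 - (n + 1 - i))"
    using assms by (intro m.reach_ge[OF y(2)]) auto
  moreover have "n + 1 - (n + 1 - i) = i"
    using assms(3) by auto
  ultimately show ?thesis
    by simp
qed

text \<open>Applying \<open>E a b\<close> raises the height \<open>\<Sum>c. c * \<nu> c\<close> by
  \<open>a - b \<ge> 1\<close>, so bounded weights force bounded word length.\<close>

lemma reach_length: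
  assumes "reach \<nu> l x"
  shows "int l + (\<Sum>a=1..n. int a * \<mu> a) \<le> (\<Sum>a=1..n. int a * \<nu> a)"
  using assms
proof induction
  case (reach_E \<nu> l x a b)
  have "(\<Sum>c=1..n. int c * (\<nu>(a := \<nu> a + 1, b := \<nu> b - 1)) c)
      = (\<Sum>c=1..n. int c * \<nu> c + (if c = a then int c else 0) - (if c = b then int c else 0))"
    using reach_E.hyps by (intro sum.cong) (auto simp: algebra_simps)
  also have "\<dots> = (\<Sum>c=1..n. int c * \<nu> c) + int a - int b"
    using reach_E.hyps by (simp add: sum.distrib sum_subtractf)
  finally show ?case
    using reach_E by simp
qed simp

lemma finite_reachable: "finite reachable"
proof -
  have fin: "finite {x. \<exists>\<nu>. reach \<nu> l x}" for l
  proof (induction l)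
    case 0
    have "{x. \<exists>\<nu>. reach \<nu> 0 x} \<subseteq> {v}"
      by (auto elim: reach.cases)
    then show ?case by (rule finite_subset) simp
  next
    case (Suc l)
    have "{x. \<exists>\<nu>. reach \<nu> (Suc l) x}
        \<subseteq> (\<lambda>(a, b, x). E a b x) ` ({1..n} \<times> {1..n} \<times> {x. \<exists>\<nu>. reach \<nu> l x})"
    proof
      fix y assume "y \<in> {x. \<exists>\<nu>. reach \<nu> (Suc l) x}"
      then obtain \<nu> a b x where "y = E a b x" "reach \<nu> l x" "a \<in> {1..n}" "b \<in> {1..n}"
        by (auto elim: reach.cases)
      then show "y \<in> (\<lambda>(a, b, x). E a b x) ` ({1..n} \<times> {1..n} \<times> {x. \<exists>\<nu>. reach \<nu> l x})"
        by (intro image_eqI[of _ _ "(a, b, x)"]) auto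
    qed
    then show ?case
      by (rule finite_subset) (use Suc in auto)
  qed
  \<comment> \<open>The height with all coordinates at their bound \<open>\<mu> 1\<close>, less the
    height of \<open>\<mu>\<close>.\<close>
  define H where "H = nat ((\<Sum>a=1..n. int a * \<mu> 1) - (\<Sum>a=1..n. int a * \<mu> a))"
  have "l \<le> H" if "reach \<nu> l x" "x \<noteq> 0" for \<nu> l x
  proof -
    have "(\<Sum>a=1..n. int a * \<nu> a) \<le> (\<Sum>a=1..n. int a * \<mu> 1)"
      using reach_le[OF that] by (intro sum_mono mult_left_mono) auto
    then show ?thesis
      using reach_length[OF that(1)] by (simp add: H_def)
  qed
  then have "reachable \<subseteq> insert 0 (\<Union>l\<le>H. {x. \<exists>\<nu>. reach \<nu> l x})"
    by blast
  then show ?thesis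
    by (rule finite_subset) (simp add: fin)
qed

text \<open>\<open>N\<close> applications lower coordinate \<open>i\<close> by \<open>N\<close>, but
  for nonzero vectors it stays between \<open>\<mu> n\<close> and \<open>\<mu> 1\<close>.\<close>

lemma lower_power_zero:
  assumes x: "x \<in> cyclic_sub sc n E v" and i: "i \<in> {1..<n}" and N: "int N > \<mu> 1 - \<mu> n"
  shows "(E (i + 1) i ^^ N) x = 0"
proof -
  have in_n: "i + 1 \<in> {1..n}" "i \<in> {1..n}"
    using i by auto
  have reach_power: "\<exists>\<nu>'. reach \<nu>' (l + m) ((E (i + 1) i ^^ m) x) \<and> \<nu>' i = \<nu> i - int m"
    if "reach \<nu> l x" for \<nu> l x m
  proof (induction m)
    case 0
    then show ?case using that by auto
  next
    case (Suc m)
    then obtain \<nu>' where \<nu>': "reach \<nu>' (l + m) ((E (i + 1) i ^^ m) x)" "\<nu>' i = \<nu> i - int m"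
      by blast
    show ?case
      using reach_E[OF \<nu>'(1) in_n] \<nu>'(2)
      by (intro exI[of _ "\<nu>'(i + 1 := \<nu>' (i + 1) + 1, i := \<nu>' i - 1)"]) (simp del: fun_upd_apply, simp)
  qed
  have zero: "(E (i + 1) i ^^ N) x = 0" if x: "reach \<nu> l x" for \<nu> l x
  proof (rule ccontr)
    assume nz: "(E (i + 1) i ^^ N) x \<noteq> 0"
    then have "x \<noteq> 0"
      using funpow_E_zero in_n by auto
    obtain \<nu>' where \<nu>': "reach \<nu>' (l + N) ((E (i + 1) i ^^ N) x)" "\<nu>' i = \<nu> i - int N"
      using reach_power[OF x] by blast
    show False
      using reach_ge[OF \<nu>'(1) nz in_n(2)] reach_le[OF x \<open>x \<noteq> 0\<close> in_n(2)] \<nu>'(2) N by simp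
  qed
  have add: "(E (i + 1) i ^^ N) (x + y) = (E (i + 1) i ^^ N) x + (E (i + 1) i ^^ N) y" for x y
    using in_n by (induction N) (simp_all add: E_add)
  have scale: "(E (i + 1) i ^^ N) (sc c x) = sc c ((E (i + 1) i ^^ N) x)" for c x
    using in_n by (induction N) (simp_all add: E_scale)
  have "x \<in> span reachable"
    using x cyclic_sub_subset_span by blast
  then show ?thesis
  proof (induction rule: span_induct_alt)
    case base
    then show ?case using funpow_E_zero in_n by simp
  next
    case (step c x y)
    then show ?case using zero unfolding add scale by auto
  qed
qed

end

section \<open>Highest weight vectors of Yangian representations\<close>

text \<open>The index set is arbitrary so that a pair \<open>{i, j}\<close> can be cut out of
  \<open>{1..n}\<close>, and \<open>S\<close> includes the coefficient \<open>r = 0\<close> so that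
  the series can be multiplied by scalar series.\<close>

locale rtt_rep = vector_space sc for sc :: "'k::field \<Rightarrow> 'v::ab_group_add \<Rightarrow> 'v" +
  fixes I :: "nat set" and S :: "nat \<Rightarrow> nat \<Rightarrow> nat \<Rightarrow> 'v \<Rightarrow> 'v"
  assumes lin: "\<lbrakk>i \<in> I; j \<in> I\<rbrakk> \<Longrightarrow> Vector_Spaces.linear sc sc (S i j r)"
    and S_0: "\<lbrakk>i \<in> I; j \<in> I\<rbrakk> \<Longrightarrow> S i j 0 x = (if i = j then x else 0)"
    and rel: "\<lbrakk>i \<in> I; j \<in> I; k \<in> I; l \<in> I\<rbrakk> \<Longrightarrow>
      (S i j (Suc r) (S k l s x) - S k l s (S i j (Suc r) x))
      - (S i j r (S k l (Suc s) x) - S k l (Suc s) (S i j r x))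
      = S k j r (S i l s x) - S k j s (S i l r x)"
begin

lemma
  assumes "i \<in> I" "j \<in> I"
  shows S_add: "S i j r (x + y) = S i j r x + S i j r y"
    and S_scale: "S i j r (sc c x) = sc c (S i j r x)"
    and S_zero: "S i j r 0 = 0"
    and S_diff: "S i j r (x - y) = S i j r x - S i j r y"
    and S_sum: "S i j r (sum f A) = (\<Sum>a\<in>A. S i j r (f a))"
  using lin[OF assms] by (auto simp: linear_iff_module_hom intro: module_hom.add module_hom.scale
      module_hom.zero module_hom.diff module_hom.sum)

lemma comm_1:
  assumes "i \<in> I" "j \<in> I" "k \<in> I" "l \<in> I"
  shows "S i j (Suc 0) (S k l s x) = S k l s (S i j (Suc 0) x)
    + ((if k = j then S i l s x else 0) - (if i = l then S k j s x else 0))"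
  using rel[OF assms, of 0 s x] assms
  by (simp add: S_0 S_zero algebra_simps split: if_splits)

end

text \<open>The coefficients of \<open>g(u) S(u)\<close> for a scalar series \<open>g\<close> in \<open>u\<^sup>-\<^sup>1\<close>.\<close>

definition twist :: "('k::field \<Rightarrow> 'v::ab_group_add \<Rightarrow> 'v) \<Rightarrow> 'k fps
    \<Rightarrow> (nat \<Rightarrow> nat \<Rightarrow> nat \<Rightarrow> 'v \<Rightarrow> 'v) \<Rightarrow> nat \<Rightarrow> nat \<Rightarrow> nat \<Rightarrow> 'v \<Rightarrow> 'v" where
  "twist sc g S i j r x = (\<Sum>m\<le>r. sc (g $ m) (S i j (r - m) x))"

context rtt_rep
begin

lemma twist_Suc:
  "twist sc g S i j (Suc r) x = (\<Sum>m\<le>r. sc (g $ m) (S i j (Suc (r - m)) x)) + sc (g $ Suc r) (S i j 0 x)"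
  by (simp add: twist_def Suc_diff_le)

lemma twist_linear:
  assumes "i \<in> I" "j \<in> I"
  shows "Vector_Spaces.linear sc sc (twist sc g S i j r)"
  using assms vector_space_axioms
  by (auto simp: Vector_Spaces.linear_iff twist_def S_add S_scale scale_right_distrib sum.distrib
      scale_sum_right mult.commute)

text \<open>The relation is linear in the coefficients indexed by \<open>r\<close>. The only term
  without a partner is the one with \<open>S i j 0\<close>, which is scalar and drops out of the
  commutator.\<close>

lemma twist_left_rel:
  assumes I: "i \<in> I" "j \<in> I" "k \<in> I" "l \<in> I"
  shows "(twist sc g S i j (Suc r) (S k l s x) - S k l s (twist sc g S i j (Suc r) x))
      - (twist sc g S i j r (S k l (Suc s) x) - S k l (Suc s) (twist sc g S i j r x))
      = twist sc g S k j r (S i l s x) - S k j s (twist sc g S i l r x)"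
proof -
  have c: "sc (g $ Suc r) (S i j 0 (S k l s x)) - S k l s (sc (g $ Suc r) (S i j 0 x)) = 0"
    using I by (simp add: S_0 S_scale S_zero)
  have "(twist sc g S i j (Suc r) (S k l s x) - S k l s (twist sc g S i j (Suc r) x))
      - (twist sc g S i j r (S k l (Suc s) x) - S k l (Suc s) (twist sc g S i j r x))
      = (\<Sum>m\<le>r. sc (g $ m) ((S i j (Suc (r - m)) (S k l s x) - S k l s (S i j (Suc (r - m)) x))
      - (S i j (r - m) (S k l (Suc s) x) - S k l (Suc s) (S i j (r - m) x))))"
    using c unfolding twist_Suc
    by (simp add: twist_def S_add S_sum S_scale I sum_subtractf scale_right_diff_distrib)
  also have "\<dots> = (\<Sum>m\<le>r. sc (g $ m) (S k j (r - m) (S i l s x) - S k j s (S i l (r - m) x)))"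
    by (simp only: rel[OF I])
  also have "\<dots> = twist sc g S k j r (S i l s x) - S k j s (twist sc g S i l r x)"
    by (simp add: twist_def S_sum S_scale I sum_subtractf scale_right_diff_distrib)
  finally show ?thesis .
qed

text \<open>Having twisted the left factor, the same linearity in \<open>s\<close> twists the right
  one.\<close>

lemma twist_rtt_rep:
  assumes "g $ 0 = 1"
  shows "rtt_rep sc I (twist sc g S)"
proof (intro rtt_rep.intro rtt_rep_axioms.intro)
  show "vector_space sc" ..
  fix i j assume I: "i \<in> I" "j \<in> I"
  let ?S = "twist sc g S"
  show "Vector_Spaces.linear sc sc (?S i j r)" for r
    using I by (rule twist_linear)
  show "?S i j 0 x = (if i = j then x else 0)" for x
    using I assms by (simp add: twist_def S_0)
  fix k l r s x assume "k \<in> I" "l \<in> I"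
  note I = I this
  have tw_add: "?S a b r (y + z) = ?S a b r y + ?S a b r z"
    and tw_scale: "?S a b r (sc c y) = sc c (?S a b r y)"
    and tw_zero: "?S a b r 0 = 0"
    and tw_sum: "?S a b r (sum f A) = (\<Sum>a'\<in>A. ?S a b r (f a'))"
    if "a \<in> I" "b \<in> I" for a b r y z c A and f :: "nat \<Rightarrow> 'v"
    using twist_linear[OF that, of g r]
    by (auto simp: linear_iff_module_hom intro: module_hom.add module_hom.scale module_hom.zero module_hom.sum)
  have c: "?S i j r (sc (g $ Suc s) (S k l 0 x)) - sc (g $ Suc s) (S k l 0 (?S i j r x)) = 0"
    using I by (simp add: S_0 tw_scale tw_zero)
  have "(?S i j (Suc r) (?S k l s x) - ?S k l s (?S i j (Suc r) x))
      - (?S i j r (?S k l (Suc s) x) - ?S k l (Suc s) (?S i j r x))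
      = (\<Sum>m\<le>s. sc (g $ m) ((?S i j (Suc r) (S k l (s - m) x) - S k l (s - m) (?S i j (Suc r) x))
      - (?S i j r (S k l (Suc (s - m)) x) - S k l (Suc (s - m)) (?S i j r x))))"
  proof -
    have *: "?S a b q (?S c d s y) = (\<Sum>m\<le>s. sc (g $ m) (?S a b q (S c d (s - m) y)))"
      if "a \<in> I" "b \<in> I" for a b c d q s y
      by (subst (2) twist_def) (simp add: tw_sum tw_scale that)
    have **: "?S i j r (?S k l (Suc s) x) = (\<Sum>m\<le>s. sc (g $ m) (?S i j r (S k l (Suc (s - m)) x)))
        + ?S i j r (sc (g $ Suc s) (S k l 0 x))"
      unfolding twist_Suc by (simp add: tw_sum tw_scale tw_add I)
    have ***: "?S k l s y = (\<Sum>m\<le>s. sc (g $ m) (S k l (s - m) y))" for y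
      by (simp add: twist_def)
    show ?thesis
      using c I unfolding *[OF I(1,2), of "Suc r"] ** ***[of "?S i j (Suc r) x"]
      unfolding twist_Suc[of g k l s]
      by (simp add: sum_subtractf scale_right_diff_distrib)
  qed
  also have "\<dots> = (\<Sum>m\<le>s. sc (g $ m) (?S k j r (S i l (s - m) x) - S k j (s - m) (?S i l r x)))"
    by (simp only: twist_left_rel[OF I])
  also have "\<dots> = ?S k j r (?S i l s x) - ?S k j s (?S i l r x)"
  proof -
    have "?S k j r (?S i l s x) = (\<Sum>m\<le>s. sc (g $ m) (?S k j r (S i l (s - m) x)))"
      by (subst (2) twist_def) (simp add: tw_sum tw_scale I)
    moreover have "?S k j s y = (\<Sum>m\<le>s. sc (g $ m) (S k j (s - m) y))" for y
      by (simp add: twist_def)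
    ultimately show ?thesis
      by (simp add: sum_subtractf scale_right_diff_distrib)
  qed
  finally show "?S i j (Suc r) (?S k l s x) - ?S k l s (?S i j (Suc r) x)
      - (?S i j r (?S k l (Suc s) x) - ?S k l (Suc s) (?S i j r x))
      = ?S k j r (?S i l s x) - ?S k j s (?S i l r x)" .
qed

lemma twist_eigenvector:
  assumes "\<And>r. S i i r x = sc (F $ r) x"
  shows "twist sc g S i i r x = sc ((g * F) $ r) x"
  by (simp add: twist_def assms fps_mult_nth scale_sum_left atLeast0AtMost)

lemma twist_1:
  assumes "i \<in> I" "j \<in> I" "i \<noteq> j" "g $ 0 = 1"
  shows "twist sc g S i j (Suc 0) x = S i j (Suc 0) x"
  using assms by (simp add: twist_def S_0)

lemma rtt_rep_subset: "J \<subseteq> I \<Longrightarrow> rtt_rep sc J S"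
  by (intro rtt_rep.intro rtt_rep_axioms.intro vector_space_axioms lin S_0 rel) auto

end

section \<open>Highest weight vectors in rank two and their \<open>f\<close>-strings\<close>

locale rtt_hw = rtt_rep +
  fixes i j :: nat and \<xi> :: 'b and F G :: "'a fps"
  assumes I: "i \<in> I" "j \<in> I" "i \<noteq> j"
    and \<xi>_nonzero: "\<xi> \<noteq> 0"
    and b_\<xi>: "S i j r \<xi> = 0"
    and a_\<xi>: "S i i r \<xi> = sc (F $ r) \<xi>"
    and d_\<xi>: "S j j r \<xi> = sc (G $ r) \<xi>"
begin

abbreviation "f \<equiv> S j i (Suc 0)"
abbreviation "e \<equiv> S i j (Suc 0)"

lemma F_0: "F $ 0 = 1" and G_0: "G $ 0 = 1"
proof -
  have "sc (F $ 0) \<xi> = sc 1 \<xi>" "sc (G $ 0) \<xi> = sc 1 \<xi>"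
    using a_\<xi>[of 0] d_\<xi>[of 0] I by (simp_all add: S_0)
  then show "F $ 0 = 1" "G $ 0 = 1"
    using \<xi>_nonzero by (simp_all only: scale_cancel_right) simp_all
qed

lemma e_c_\<xi>: "e (S j i r \<xi>) = sc (F $ r - G $ r) \<xi>"
  using comm_1[of i j j i r \<xi>] I b_\<xi>
  by (simp add: a_\<xi> d_\<xi> S_zero scale_left_diff_distrib)

lemma f_c: "f (S j i r x) = S j i r (f x)"
  using comm_1[of j i j i r x] I by simp

lemma f_power_c: "(f ^^ m) (S j i r x) = S j i r ((f ^^ m) x)"
  by (induction m) (simp_all only: funpow.simps comp_apply id_apply f_c)

lemma f_a: "f (S i i r x) = S i i r (f x) + S j i r x"
  using comm_1[of j i i i r x] I by (auto simp: eq_commute)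

lemma a_f_power: "S i i r ((f ^^ m) x) = (f ^^ m) (S i i r x) - sc (of_nat m) ((f ^^ (m - 1)) (S j i r x))"
proof (induction m)
  case (Suc m)
  have "sc (of_nat m) (f ((f ^^ (m - 1)) (S j i r x))) = sc (of_nat m) ((f ^^ m) (S j i r x))"
    by (cases m) simp_all
  then have "f (S i i r ((f ^^ m) x)) = f ((f ^^ m) (S i i r x)) - sc (of_nat m) ((f ^^ m) (S j i r x))"
    using I by (simp add: Suc.IH S_diff S_scale)
  then have "S i i r (f ((f ^^ m) x)) = f ((f ^^ m) (S i i r x))
      - (sc (of_nat m) ((f ^^ m) (S j i r x)) + (f ^^ m) (S j i r x))"
    using f_a[of r "(f ^^ m) x"] by (simp add: f_power_c algebra_simps)
  then show ?case
    by (simp add: scale_left_distrib add.commute)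
qed simp

lemma f_power_diff: "(f ^^ m) (x - y) = (f ^^ m) x - (f ^^ m) y"
  and f_power_scale: "(f ^^ m) (sc c x) = sc c ((f ^^ m) x)"
  using I by (induction m) (simp_all add: S_diff S_scale)

text \<open>The usual string formula of \<open>sl_2\<close>, with \<open>S i i 1 - S j j 1\<close>
  as Cartan element.\<close>

lemma e_f_power:
  assumes "\<And>r. S i i (Suc 0) x - S j j (Suc 0) x = sc h x" "e x = 0"
  shows "e ((f ^^ m) x) = sc (of_nat m * (h - of_nat (m - 1))) ((f ^^ (m - 1)) x)"
proof -
  have H: "S i i (Suc 0) ((f ^^ m) x) - S j j (Suc 0) ((f ^^ m) x) = sc (h - 2 * of_nat m) ((f ^^ m) x)" for m
  proof (induction m)
    case 0
    then show ?case using assms by simp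
  next
    case (Suc m)
    let ?z = "(f ^^ m) x"
    have "S i i (Suc 0) (f ?z) = f (S i i (Suc 0) ?z) - f ?z" "S j j (Suc 0) (f ?z) = f (S j j (Suc 0) ?z) + f ?z"
      using comm_1[of i i j i "Suc 0" ?z] comm_1[of j j j i "Suc 0" ?z] I by auto
    then have "S i i (Suc 0) (f ?z) - S j j (Suc 0) (f ?z) = f (S i i (Suc 0) ?z - S j j (Suc 0) ?z) - f ?z - f ?z"
      using I by (simp add: S_diff)
    also have "\<dots> = sc (h - 2 * of_nat (Suc m)) (f ?z)"
      unfolding Suc using I scale_left_distrib[of 1 1 "f ?z"]
      by (simp add: S_diff S_scale scale_left_diff_distrib scale_left_distrib distrib_left)
    finally show ?case by simp
  qed
  show ?thesis
  proof (induction m)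
    case 0
    then show ?case using assms by simp
  next
    case (Suc m)
    let ?z = "(f ^^ m) x"
    have "sc (of_nat m * (h - of_nat (m - 1))) (f ((f ^^ (m - 1)) x)) = sc (of_nat m * (h - of_nat (m - 1))) ?z"
      by (cases m) simp_all
    moreover have "e (f ?z) = f (e ?z) + (S i i (Suc 0) ?z - S j j (Suc 0) ?z)"
      using comm_1[of i j j i "Suc 0" ?z] I by simp
    ultimately have "e (f ?z) = sc (of_nat m * (h - of_nat (m - 1)) + (h - 2 * of_nat m)) ?z"
      using I by (simp add: Suc.IH H S_scale scale_left_distrib)
    also have "of_nat m * (h - of_nat (m - 1)) + (h - 2 * of_nat m) = of_nat (Suc m) * (h - of_nat m)"
      by (cases m) (simp_all add: algebra_simps)
    finally show ?case by simp
  qed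
qed

text \<open>The bottom of the \<open>f\<close>-string through \<open>\<xi>\<close> is a lowest weight vector, on which the two
  diagonal series are interchanged.\<close>

lemma lowest_vector:
  assumes p: "\<And>m. \<lbrakk>0 < m; m < p\<rbrakk> \<Longrightarrow> of_nat m \<noteq> (0 :: 'a)"
    and nil: "(f ^^ (p - 1)) \<xi> = 0"
  obtains k where "(f ^^ k) \<xi> \<noteq> 0" "\<And>r. S i i r ((f ^^ k) \<xi>) = sc (G $ r) ((f ^^ k) \<xi>)"
proof -
  \<comment> \<open>\<open>k < p - 1\<close> will make \<open>k + 1\<close> invertible, and
    \<open>k\<close> as well unless it is zero.\<close>
  define k where "k = (LEAST m. (f ^^ Suc m) \<xi> = 0)"
  have "p - 1 > 0"
    using nil \<xi>_nonzero by (cases "p - 1") auto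
  then have ex: "(f ^^ Suc (p - 2)) \<xi> = 0"
    using nil by (metis Suc_diff_Suc Suc_1 diff_Suc_1 numeral_2_eq_2 zero_less_diff)
  have k0: "(f ^^ Suc k) \<xi> = 0"
    unfolding k_def using ex by (rule LeastI)
  have "k \<le> p - 2"
    unfolding k_def using ex by (rule Least_le)
  then have kp: "k + 1 < p"
    using \<open>p - 1 > 0\<close> by linarith
  have nz: "(f ^^ k) \<xi> \<noteq> 0"
  proof (cases k)
    case (Suc m)
    then show ?thesis
      using not_less_Least[of m "\<lambda>m. (f ^^ Suc m) \<xi> = 0"] unfolding k_def by auto
  qed (simp add: \<xi>_nonzero)
  have S1: "of_nat (Suc k) \<noteq> (0 :: 'a)"
    using kp by (intro p) auto
  \<comment> \<open>Applying \<open>e\<close> to \<open>(f ^^ Suc k) \<xi> = 0\<close> forces the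
    weight of \<open>\<xi>\<close> to be \<open>k\<close> in the field.\<close>
  have "sc (of_nat (Suc k) * ((F $ Suc 0 - G $ Suc 0) - of_nat k)) ((f ^^ k) \<xi>) = 0"
    using e_f_power[of \<xi> "F $ Suc 0 - G $ Suc 0" "Suc k"] k0 b_\<xi> I
    by (simp add: a_\<xi> d_\<xi> scale_left_diff_distrib S_zero)
  then have h: "F $ Suc 0 - G $ Suc 0 = of_nat k"
    using nz S1 by auto
  \<comment> \<open>In \<open>a_f_power\<close> at \<open>k + 1\<close> all terms but one contain
    \<open>(f ^^ Suc k) \<xi> = 0\<close>; the remaining one has the invertible factor
    \<open>k + 1\<close>.\<close>
  have fkc: "(f ^^ k) (S j i r \<xi>) = 0" for r
  proof -
    have "sc (of_nat (Suc k)) ((f ^^ k) (S j i r \<xi>)) = 0"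
      using a_f_power[of r "Suc k" \<xi>] I unfolding k0 a_\<xi> f_power_scale
      by (simp add: S_zero)
    then show ?thesis using S1 by simp
  qed
  have "S i i r ((f ^^ k) \<xi>) = sc (G $ r) ((f ^^ k) \<xi>)" for r
  proof (cases k)
    case 0
    then have "sc (F $ r - G $ r) \<xi> = 0"
      using e_c_\<xi>[of r] fkc[of r] I by (simp add: S_zero)
    then show ?thesis
      using 0 \<xi>_nonzero a_\<xi>[of r] by simp
  next
    case (Suc k')
    have k: "of_nat k \<noteq> (0 :: 'a)"
      using kp Suc by (intro p) auto
    have H: "S i i (Suc 0) (S j i r \<xi>) - S j j (Suc 0) (S j i r \<xi>) = sc (of_nat k - 2) (S j i r \<xi>)" for r
      using comm_1[of i i j i r \<xi>] comm_1[of j j j i r \<xi>] I scale_left_distrib[of 1 1 "S j i r \<xi>"]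
      by (simp add: a_\<xi> d_\<xi> S_scale h[symmetric] scale_left_diff_distrib)
    \<comment> \<open>\<open>e\<close> sends \<open>S j i r \<xi>\<close> to
      \<open>(F $ r - G $ r) \<xi>\<close> and \<open>f \<xi>\<close> to \<open>k \<xi>\<close>, so
      it kills this combination, which has weight \<open>k - 2\<close>.\<close>
    define y where "y = sc (of_nat k) (S j i r \<xi>) - sc (F $ r - G $ r) (f \<xi>)"
    have "e y = 0"
      unfolding y_def using I by (simp only: S_diff S_scale e_c_\<xi> h) (simp add: mult.commute)
    moreover have "S i i (Suc 0) y - S j j (Suc 0) y = sc (of_nat k - 2) y"
    proof -
      have "S i i (Suc 0) y - S j j (Suc 0) y = sc (of_nat k) (S i i (Suc 0) (S j i r \<xi>) - S j j (Suc 0) (S j i r \<xi>))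
          - sc (F $ r - G $ r) (S i i (Suc 0) (f \<xi>) - S j j (Suc 0) (f \<xi>))"
        unfolding y_def using I by (simp add: S_diff S_scale scale_right_diff_distrib)
      then show ?thesis
        unfolding H y_def by (simp add: scale_right_diff_distrib mult.commute)
    qed
    \<comment> \<open>Since \<open>f ^^ k\<close> kills \<open>y\<close> and the coefficient equals
      \<open>-k\<close>, already \<open>f ^^ (k - 1)\<close> kills \<open>y\<close>. This evaluates
      the correction term in \<open>a_f_power\<close> and changes \<open>F\<close> into
      \<open>G\<close>.\<close>
    ultimately have "e ((f ^^ k) y) = sc (of_nat k * (of_nat k - 2 - of_nat (k - 1))) ((f ^^ (k - 1)) y)"
      by (intro e_f_power)
    moreover have "(f ^^ k) y = 0"
      using k0 fkc unfolding y_def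
      by (simp add: f_power_diff f_power_scale funpow_swap1)
    moreover have "of_nat k * (of_nat k - 2 - of_nat (k - 1)) = (- of_nat k :: 'a)"
      by (simp add: Suc)
    ultimately have "sc (- of_nat k) ((f ^^ (k - 1)) y) = 0"
      using I by (simp only: S_zero)
    then have "(f ^^ (k - 1)) y = 0"
      using k by simp
    then have "sc (of_nat k) ((f ^^ (k - 1)) (S j i r \<xi>)) = sc (F $ r - G $ r) ((f ^^ k) \<xi>)"
      unfolding y_def by (simp add: f_power_diff f_power_scale Suc) (simp add: funpow_swap1)
    then show ?thesis
      using a_f_power[of r k \<xi>] by (simp add: a_\<xi> f_power_scale scale_left_diff_distrib)
  qed
  then show thesis
    using that nz by blast
qed

text \<open>In the relation for \<open>d_2\<close> and \<open>c_r\<close>, the quadratic terms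
  \<open>d_1 c_r \<xi>\<close> and \<open>d_r c_1 \<xi>\<close> both equal \<open>c_r \<xi>\<close>
  and cancel.\<close>

lemma d_2_c_\<xi>:
  assumes "G = 1" "r \<ge> 1"
  shows "S j j 2 (S j i r \<xi>) = S j i (Suc r) \<xi>"
proof -
  have d0: "S j j r \<xi> = 0" if "r \<ge> 1" for r
    using that d_\<xi>[of r] assms by simp
  have "S j j (Suc 0) (S j i r \<xi>) = S j i r \<xi>" for r
    using comm_1[of j j j i r \<xi>] I d0[of "Suc 0"] by (simp add: S_zero)
  moreover have "S j j r (f \<xi>) = S j i r \<xi>"
    using comm_1[of j i j j r \<xi>] I d0[of r] assms by (simp add: S_zero)
  ultimately show ?thesis
    using rel[of j j j i "Suc 0" r \<xi>] I d0[of "Suc 0"] d0[of 2] by (simp add: S_zero numeral_2_eq_2)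
qed

end

text \<open>Otherwise the first \<open>card B + 1\<close> terms would be independent in the span of
  \<open>B\<close>.\<close>

lemma (in vector_space) sequence_dependence:
  fixes w :: "nat \<Rightarrow> 'b"
  assumes "finite B" "range w \<subseteq> span B"
  obtains m q where "w m = (\<Sum>s<m. scale (q s) (w s))"
proof -
  have "\<exists>m. w m \<in> span (w ` {..<m})"
  proof (rule ccontr)
    assume *: "\<nexists>m. w m \<in> span (w ` {..<m})"
    have "independent (w ` {..<m}) \<and> card (w ` {..<m}) = m" for m
    proof (induction m)
      case (Suc m)
      have new: "w m \<notin> span (w ` {..<m})"
        using * by blast
      then have "w m \<notin> w ` {..<m}"
        using span_base[of "w m" "w ` {..<m}"] by blast
      then show ?case
        using Suc independent_insertI[OF new] by (simp add: lessThan_Suc)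
    qed (simp add: independent_empty)
    from this[of "Suc (card B)"] have "Suc (card B) \<le> card B"
      using independent_span_bound[OF assms(1), of "w ` {..<Suc (card B)}"] assms(2) by auto
    then show False
      by simp
  qed
  then obtain m where m: "w m \<in> span (w ` {..<m})" by blast
  have "\<exists>q. x = (\<Sum>s<m. scale (q s) (w s))" if "x \<in> span (w ` {..<m})" for x
    using that
  proof (induction rule: span_induct_alt)
    case base
    show ?case by (rule exI[of _ "\<lambda>_. 0"]) simp
  next
    case (step c x y)
    obtain t where t: "x = w t" "t < m"
      using step.hyps by auto
    obtain q where q: "y = (\<Sum>s<m. scale (q s) (w s))"
      using step.IH by blast
    have "(\<Sum>s<m. scale (if s = t then c else 0) (w s)) = (\<Sum>s<m. if s = t then scale c (w s) else 0)"
      by (intro sum.cong) auto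
    then have "scale c x + y = (\<Sum>s<m. scale (q s + (if s = t then c else 0)) (w s))"
      using t by (simp add: q scale_left_distrib sum.distrib)
    then show ?case
      by (intro exI[of _ "\<lambda>s. q s + (if s = t then c else 0)"])
  qed
  from this[OF m] show thesis
    using that by blast
qed

section \<open>Clearing denominators by a scalar series\<close>

context rtt_hw
begin

lemma twist_rtt_hw:
  assumes "g $ 0 = 1"
  shows "rtt_hw sc I (twist sc g S) i j \<xi> (g * F) (g * G)"
proof (intro rtt_hw.intro rtt_hw_axioms.intro twist_rtt_rep[OF assms] I \<xi>_nonzero)
  show "twist sc g S i j r \<xi> = 0" for r
    by (simp add: twist_def b_\<xi>)
  show "twist sc g S i i r \<xi> = sc ((g * F) $ r) \<xi>" for r
    by (rule twist_eigenvector[OF a_\<xi>])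
  show "twist sc g S j j r \<xi> = sc ((g * G) $ r) \<xi>" for r
    by (rule twist_eigenvector[OF d_\<xi>])
qed

text \<open>Once \<open>d(u)\<close> fixes \<open>\<xi>\<close>, its second coefficient acts on the coefficients of \<open>c(u)\<xi>\<close>
  as the index shift, so a linear dependence between them propagates.\<close>

lemma exists_denominator:
  assumes "G = 1" "finite B" "span B = UNIV"
  obtains g D where "g $ 0 = 1" "\<And>N. N > D \<Longrightarrow> g $ N = 0" "\<And>N. N > D \<Longrightarrow> twist sc g S j i N \<xi> = 0"
proof -
  obtain m q where q: "S j i (Suc m) \<xi> = (\<Sum>s<m. sc (q s) (S j i (Suc s) \<xi>))"
    using sequence_dependence[of B "\<lambda>s. S j i (Suc s) \<xi>"] assms by blast
  have rec: "S j i (Suc m + t) \<xi> = (\<Sum>s<m. sc (q s) (S j i (Suc s + t) \<xi>))" for t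
  proof (induction t)
    case 0
    then show ?case using q by simp
  next
    case (Suc t)
    have "S j i (Suc m + Suc t) \<xi> = S j j 2 (S j i (Suc m + t) \<xi>)"
      using d_2_c_\<xi>[OF assms(1)] by simp
    also have "\<dots> = (\<Sum>s<m. sc (q s) (S j i (Suc s + Suc t) \<xi>))"
      unfolding Suc using I d_2_c_\<xi>[OF assms(1)] by (simp add: S_sum S_scale)
    finally show ?case .
  qed
  \<comment> \<open>The reversal of the recurrence polynomial
    \<open>u^m - (\<Sum>s<m. q s * u^s)\<close>; multiplying by it makes all coefficients beyond
    \<open>m\<close> vanish.\<close>
  define g where "g = Abs_fps (\<lambda>N. if N = 0 then 1 else if N \<le> m then - q (m - N) else 0)"
  have "twist sc g S j i N \<xi> = 0" if "N > m" for N
  proof -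
    have "twist sc g S j i N \<xi> = S j i N \<xi> + (\<Sum>t\<in>{1..N}. sc (g $ t) (S j i (N - t) \<xi>))"
      by (simp add: twist_def g_def atMost_atLeast0 sum.atLeast_Suc_atMost)
    also have "(\<Sum>t\<in>{1..N}. sc (g $ t) (S j i (N - t) \<xi>)) = (\<Sum>t\<in>{1..m}. sc (g $ t) (S j i (N - t) \<xi>))"
      using that by (intro sum.mono_neutral_right) (auto simp: g_def)
    also have "\<dots> = (\<Sum>s<m. - sc (q s) (S j i (N - m + s) \<xi>))"
      using that by (intro sum.reindex_bij_witness[of _ "\<lambda>s. m - s" "\<lambda>t. m - t"]) (auto simp: g_def)
    also have "\<dots> = - (\<Sum>s<m. sc (q s) (S j i (Suc s + (N - Suc m)) \<xi>))"
      unfolding sum_negf using that by (intro arg_cong[where f = uminus] sum.cong) (auto simp: Suc_diff_Suc add.commute)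
    also have "\<dots> = - S j i N \<xi>"
      using rec[of "N - Suc m"] that by simp
    finally show ?thesis by simp
  qed
  then show thesis
    by (intro that[of g m]) (auto simp: g_def)
qed

end

section \<open>Currents acting by polynomials\<close>

locale rtt_poly = rtt_hw +
  fixes D :: nat
  assumes I_eq: "I = {i, j}"
    and F_beyond: "N > D \<Longrightarrow> F $ N = 0"
    and G_beyond: "N > D \<Longrightarrow> G $ N = 0"
    and c_beyond: "N > D \<Longrightarrow> S j i N \<xi> = 0"
begin

text \<open>On these vectors \<open>u^D\<close> times each current is a polynomial in
  \<open>u\<close>, so the relations can be evaluated at field elements.\<close>

definition Pol :: "'b set" where
  "Pol = {x. \<forall>a\<in>I. \<forall>b\<in>I. \<forall>N>D. S a b N x = 0}"

lemma \<xi>_Pol: "\<xi> \<in> Pol"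
  unfolding Pol_def by (auto simp: I_eq a_\<xi> b_\<xi> c_beyond d_\<xi> F_beyond G_beyond)

lemma PolD: "\<lbrakk>x \<in> Pol; a \<in> I; b \<in> I; N > D\<rbrakk> \<Longrightarrow> S a b N x = 0"
  by (simp add: Pol_def)

lemma zero_Pol: "0 \<in> Pol"
  by (simp add: Pol_def S_zero)

lemma Pol_add: "\<lbrakk>x \<in> Pol; y \<in> Pol\<rbrakk> \<Longrightarrow> x + y \<in> Pol"
  by (simp add: Pol_def S_add)

lemma Pol_scale: "x \<in> Pol \<Longrightarrow> sc c x \<in> Pol"
  by (simp add: Pol_def S_scale)

lemma Pol_sum: "(\<And>a. a \<in> A \<Longrightarrow> h a \<in> Pol) \<Longrightarrow> sum h A \<in> Pol"
  by (induction A rule: infinite_finite_induct) (simp_all add: zero_Pol Pol_add)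

text \<open>In the relation with \<open>r = N > D\<close> every term vanishes by induction except
  \<open>S a b N (S c d (Suc s) x)\<close>.\<close>

lemma Pol_S:
  assumes x: "x \<in> Pol" and "c \<in> I" "d \<in> I"
  shows "S c d s x \<in> Pol"
  using assms(2-)
proof (induction s arbitrary: c d)
  case 0
  then show ?case using x by (simp add: S_0 zero_Pol)
next
  case (Suc s)
  have "S a b N (S c d (Suc s) x) = 0" if "a \<in> I" "b \<in> I" "N > D" for a b N
    using rel[of a b c d N s x] that Suc PolD[OF x] PolD[OF Suc.IH]
    by (simp add: S_zero)
  then show ?case
    by (simp add: Pol_def)
qed

text \<open>The value at \<open>u\<close> of \<open>u^D\<close> times the current, truncated after
  \<open>u^-D\<close>.\<close>

definition ev :: "nat \<Rightarrow> nat \<Rightarrow> 'a \<Rightarrow> 'b \<Rightarrow> 'b" where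
  "ev a b u x = (\<Sum>N\<le>D. sc (u ^ (D - N)) (S a b N x))"

lemma Pol_ev: "\<lbrakk>x \<in> Pol; a \<in> I; b \<in> I\<rbrakk> \<Longrightarrow> ev a b u x \<in> Pol"
  unfolding ev_def by (intro Pol_sum Pol_scale Pol_S)

lemma
  assumes "a \<in> I" "b \<in> I"
  shows ev_add: "ev a b u (x + y) = ev a b u x + ev a b u y"
    and ev_scale: "ev a b u (sc c x) = sc c (ev a b u x)"
    and ev_diff: "ev a b u (x - y) = ev a b u x - ev a b u y"
  using assms by (simp_all add: ev_def S_add S_scale S_diff scale_right_distrib
      scale_right_diff_distrib sum.distrib sum_subtractf scale_sum_right mult.commute)

lemma ev_sum:
  assumes "a \<in> I" "b \<in> I"
  shows "ev a b u (sum h A) = (\<Sum>x\<in>A. ev a b u (h x))"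
  by (induction A rule: infinite_finite_induct)
    (use assms in \<open>simp_all add: ev_add\<close>, simp_all add: ev_def S_zero)

text \<open>Multiplication by \<open>u\<close> shifts the index; the overflow at
  \<open>D + 1\<close> vanishes on \<open>Pol\<close>.\<close>

lemma ev_shift:
  assumes "x \<in> Pol" "a \<in> I" "b \<in> I"
  shows "(\<Sum>r\<le>D. sc (u ^ (D - r)) (S a b (Suc r) x)) = sc u (ev a b u x) - sc (u ^ Suc D) (S a b 0 x)"
proof -
  have "(\<Sum>r\<le>Suc D. sc (u ^ (Suc D - r)) (S a b r x)) = sc u (ev a b u x)"
    using assms by (simp add: ev_def PolD scale_sum_right Suc_diff_le)
  moreover have "(\<Sum>r\<le>Suc D. sc (u ^ (Suc D - r)) (S a b r x))
      = sc (u ^ Suc D) (S a b 0 x) + (\<Sum>r\<le>D. sc (u ^ (D - r)) (S a b (Suc r) x))"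
    unfolding sum.atMost_Suc_shift by simp
  ultimately show ?thesis
    by simp
qed

text \<open>Sums the relation over \<open>r\<close> only; the boundary term with
  \<open>S a b 0\<close> is scalar and leaves the commutator.\<close>

lemma ev_S_rel:
  assumes x: "x \<in> Pol" and I: "a \<in> I" "b \<in> I" "c \<in> I" "d \<in> I"
  shows "sc u (ev a b u (S c d s x) - S c d s (ev a b u x))
      - (ev a b u (S c d (Suc s) x) - S c d (Suc s) (ev a b u x))
    = ev c b u (S a d s x) - S c b s (ev a d u x)"
proof -
  have S_ev: "S c d s (ev a b u x) = (\<Sum>r\<le>D. sc (u ^ (D - r)) (S c d s (S a b r x)))"
    if "c \<in> I" "d \<in> I" for a b c d s
    using that by (simp add: ev_def S_sum S_scale)
  have "S c d s (\<Sum>r\<le>D. sc (u ^ (D - r)) (S a b (Suc r) x))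
      = (\<Sum>r\<le>D. sc (u ^ (D - r)) (S c d s (S a b (Suc r) x)))"
    using I by (simp add: S_sum S_scale)
  then have "(\<Sum>r\<le>D. sc (u ^ (D - r)) (S a b (Suc r) (S c d s x)))
      - (\<Sum>r\<le>D. sc (u ^ (D - r)) (S c d s (S a b (Suc r) x)))
      = sc u (ev a b u (S c d s x) - S c d s (ev a b u x))"
    using I x by (cases "a = b")
      (simp_all add: ev_shift Pol_S S_0 S_diff S_scale S_zero scale_right_diff_distrib algebra_simps)
  moreover have "(\<Sum>r\<le>D. sc (u ^ (D - r)) ((S a b (Suc r) (S c d s x) - S c d s (S a b (Suc r) x))
        - (S a b r (S c d (Suc s) x) - S c d (Suc s) (S a b r x))))
      = (\<Sum>r\<le>D. sc (u ^ (D - r)) (S c b r (S a d s x) - S c b s (S a d r x)))"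
    by (simp only: rel[OF I])
  ultimately show ?thesis
    by (simp add: S_ev I ev_def[of _ _ _ "S _ _ _ _"] scale_right_diff_distrib sum_subtractf)
qed

text \<open>The two-parameter form of the defining relation, obtained by summing
  \<open>ev_S_rel\<close> over \<open>s\<close>.\<close>

lemma ev_rel:
  assumes x: "x \<in> Pol" and I: "a \<in> I" "b \<in> I" "c \<in> I" "d \<in> I"
  shows "sc (u - w) (ev a b u (ev c d w x) - ev c d w (ev a b u x))
    = ev c b u (ev a d w x) - ev c b w (ev a d u x)"
proof -
  have ev_ev: "ev a b u (ev c d w x) = (\<Sum>s\<le>D. sc (w ^ (D - s)) (ev a b u (S c d s x)))"
    if "a \<in> I" "b \<in> I" for a b c d
    unfolding ev_def[of c d] using that by (simp add: ev_sum ev_scale)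
  have "ev a b u (\<Sum>s\<le>D. sc (w ^ (D - s)) (S c d (Suc s) x))
      = (\<Sum>s\<le>D. sc (w ^ (D - s)) (ev a b u (S c d (Suc s) x)))"
    using I by (simp add: ev_sum ev_scale)
  moreover have "ev a b u 0 = 0"
    using I by (simp add: ev_def S_zero)
  ultimately have "(\<Sum>s\<le>D. sc (w ^ (D - s)) (ev a b u (S c d (Suc s) x)))
      - (\<Sum>s\<le>D. sc (w ^ (D - s)) (S c d (Suc s) (ev a b u x)))
      = sc w (ev a b u (ev c d w x) - ev c d w (ev a b u x))"
    using I x by (cases "c = d")
      (simp_all add: ev_shift Pol_ev S_0 ev_diff ev_scale scale_right_diff_distrib algebra_simps)
  moreover have "(\<Sum>s\<le>D. sc (w ^ (D - s)) (sc u (ev a b u (S c d s x) - S c d s (ev a b u x))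
        - (ev a b u (S c d (Suc s) x) - S c d (Suc s) (ev a b u x))))
      = (\<Sum>s\<le>D. sc (w ^ (D - s)) (ev c b u (S a d s x) - S c b s (ev a d u x)))"
    by (simp only: ev_S_rel[OF x I])
  moreover have "(\<Sum>s\<le>D. sc (w ^ (D - s)) (sc u (ev a b u (S c d s x) - S c d s (ev a b u x))))
      = sc u (ev a b u (ev c d w x) - ev c d w (ev a b u x))"
    unfolding ev_ev[OF I(1,2)] ev_def[of c d w "ev a b u x"]
    by (simp add: scale_right_diff_distrib sum_subtractf scale_sum_right mult.commute)
  moreover have "(\<Sum>s\<le>D. sc (w ^ (D - s)) (ev c b u (S a d s x) - S c b s (ev a d u x)))
      = ev c b u (ev a d w x) - ev c b w (ev a d u x)"
    unfolding ev_ev[OF I(3,2)] ev_def[of c b w "ev a d u x"]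
    by (simp add: scale_right_diff_distrib sum_subtractf)
  ultimately have "sc u (ev a b u (ev c d w x) - ev c d w (ev a b u x))
      - sc w (ev a b u (ev c d w x) - ev c d w (ev a b u x))
    = ev c b u (ev a d w x) - ev c b w (ev a d u x)"
    by (simp add: scale_right_diff_distrib sum_subtractf)
  then show ?thesis
    by (simp only: scale_left_diff_distrib)
qed

text \<open>At \<open>w = u - 1\<close> the factor \<open>u - w\<close> is one, and
  \<open>a(u - 1) c(u)\<close> cancels from both sides.\<close>

lemma c_a_shift:
  assumes "x \<in> Pol"
  shows "ev j i u (ev i i (u - 1) x) = ev i i u (ev j i (u - 1) x)"
  using ev_rel[OF assms, of j i i i u "u - 1"] I by simp

lemma f_ev_a: "f (ev i i u x) = ev i i u (f x) + ev j i u x"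
  using I by (simp only: ev_def S_sum S_scale f_a scale_right_distrib sum.distrib)

primrec a_prod :: "nat \<Rightarrow> 'a \<Rightarrow> 'b \<Rightarrow> 'b" where
  "a_prod 0 u x = x"
| "a_prod (Suc m) u x = ev i i u (a_prod m (u - 1) x)"

lemma Pol_a_prod: "x \<in> Pol \<Longrightarrow> a_prod m u x \<in> Pol"
  using I by (induction m arbitrary: u) (simp_all add: Pol_ev)

lemma c_a_prod:
  assumes "x \<in> Pol"
  shows "ev j i u (a_prod m (u - 1) x) = a_prod m u (ev j i (u - of_nat m) x)"
proof (induction m arbitrary: u)
  case (Suc m)
  have "ev j i u (a_prod (Suc m) (u - 1) x) = ev i i u (ev j i (u - 1) (a_prod m (u - 1 - 1) x))"
    by (simp add: c_a_shift Pol_a_prod assms)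
  also have "\<dots> = a_prod (Suc m) u (ev j i (u - 1 - of_nat m) x)"
    by (simp only: Suc a_prod.simps(2))
  also have "u - 1 - of_nat m = u - of_nat (Suc m)"
    by simp
  finally show ?case .
qed simp

text \<open>Commuting \<open>f\<close> past one factor \<open>a\<close> turns it into
  \<open>c\<close>, which \<open>c_a_prod\<close> carries to the right end. Hence all
  \<open>m + 1\<close> contributions coincide.\<close>

lemma f_a_prod:
  assumes "x \<in> Pol"
  shows "f (a_prod (Suc m) u x)
    = a_prod (Suc m) u (f x) + sc (of_nat (Suc m)) (a_prod m u (ev j i (u - of_nat m) x))"
proof (induction m arbitrary: u)
  case 0
  show ?case by (simp only: a_prod.simps f_ev_a) simp
next
  case (Suc m)
  have "f (a_prod (Suc (Suc m)) u x)
      = ev i i u (f (a_prod (Suc m) (u - 1) x)) + ev j i u (a_prod (Suc m) (u - 1) x)"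
    by (simp only: a_prod.simps(2)[of "Suc m"] f_ev_a)
  also have "ev j i u (a_prod (Suc m) (u - 1) x) = a_prod (Suc m) u (ev j i (u - of_nat (Suc m)) x)"
    by (rule c_a_prod[OF assms])
  also have "ev i i u (f (a_prod (Suc m) (u - 1) x)) = a_prod (Suc (Suc m)) u (f x)
      + sc (of_nat (Suc m)) (a_prod (Suc m) u (ev j i (u - 1 - of_nat m) x))"
    unfolding Suc using I by (simp only: ev_add ev_scale a_prod.simps(2))
  also have "u - 1 - of_nat m = u - of_nat (Suc m)"
    by simp
  finally show ?case
    by (simp only: of_nat_Suc[of "Suc m"] scale_left_distrib scale_one add_ac)
qed

text \<open>All \<open>p\<close> terms of the commutator of \<open>f\<close> with \<open>a(u) a(u - 1) \<dots> a(u - p + 1)\<close> agree.\<close>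

lemma f_power_a_prod:
  assumes "x \<in> Pol" "of_nat p = (0 :: 'a)" "p > 0"
  shows "(f ^^ k) (a_prod p u x) = a_prod p u ((f ^^ k) x) \<and> (f ^^ k) x \<in> Pol"
proof (induction k)
  case (Suc k)
  obtain m where m: "p = Suc m" using assms(3) by (cases p) auto
  have "f (a_prod p u ((f ^^ k) x)) = a_prod p u (f ((f ^^ k) x))"
    unfolding m using f_a_prod[of "(f ^^ k) x" m u] Suc assms(2) unfolding m by simp
  then show ?case
    using Suc I by (simp add: Pol_S)
qed (simp add: assms)

lemma a_prod_eigenvector:
  assumes "\<And>r. S i i r x = sc (H $ r) x"
  shows "a_prod m u x = sc (\<Prod>t<m. \<Sum>N\<le>D. H $ N * (u - of_nat t) ^ (D - N)) x"
proof (induction m arbitrary: u)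
  case (Suc m)
  have "ev i i u x = sc (\<Sum>N\<le>D. H $ N * u ^ (D - N)) x" for u
    by (simp add: ev_def assms scale_sum_left mult.commute)
  then show ?case
    using I Suc[of "u - 1"] unfolding prod.lessThan_Suc_shift by (simp add: ev_scale mult.commute algebra_simps)
qed simp

lemma norms_eq:
  assumes p: "\<And>m. \<lbrakk>0 < m; m < p\<rbrakk> \<Longrightarrow> of_nat m \<noteq> (0 :: 'a)" "of_nat p = (0 :: 'a)" "p > 0"
    and nil: "(f ^^ (p - 1)) \<xi> = 0"
  shows "(\<Prod>t<p. \<Sum>N\<le>D. F $ N * (u - of_nat t) ^ (D - N))
    = (\<Prod>t<p. \<Sum>N\<le>D. G $ N * (u - of_nat t) ^ (D - N))"
proof -
  obtain k where k: "(f ^^ k) \<xi> \<noteq> 0" "\<And>r. S i i r ((f ^^ k) \<xi>) = sc (G $ r) ((f ^^ k) \<xi>)"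
    using lowest_vector[OF p(1) nil] by blast
  have "(f ^^ k) (a_prod p u \<xi>) = a_prod p u ((f ^^ k) \<xi>)"
    using f_power_a_prod[OF \<xi>_Pol p(2,3)] by blast
  then show ?thesis
    using k(1) unfolding a_prod_eigenvector[OF k(2)] a_prod_eigenvector[OF a_\<xi>] f_power_scale
    by simp
qed

end

text \<open>Twisting by \<open>g = 1 / G\<close> makes \<open>d(u)\<close> trivial on
  \<open>\<xi>\<close>, as \<open>exists_denominator\<close> requires. Twisting by the denominator
  \<open>h\<close> then turns the two series into polynomials \<open>A\<close> and \<open>B\<close>
  with \<open>F / G = A / B\<close>.\<close>

lemma (in rtt_hw) drinfeld_polynomial:
  assumes closed: "\<forall>P :: 'a poly. degree P \<ge> 1 \<longrightarrow> (\<exists>x. poly P x = 0)"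
    and p: "\<And>m. \<lbrakk>0 < m; m < p\<rbrakk> \<Longrightarrow> of_nat m \<noteq> (0 :: 'a)" "of_nat p = (0 :: 'a)" "p > 0"
    and I_eq: "I = {i, j}"
    and nil: "(f ^^ (p - 1)) \<xi> = 0"
    and fin: "finite B" "span B = UNIV"
  shows "\<exists>P. lead_coeff P = 1 \<and> F * fps_of_poly (reflect_poly P)
    = G * fps_of_poly (reflect_poly (pcompose P [:1, 1:]))"
proof -
  define g where "g = inverse G"
  have g0: "g $ 0 = 1" and gG: "g * G = 1"
    using G_0 by (simp_all add: g_def inverse_mult_eq_1)
  define T where "T = twist sc g S"
  interpret T: rtt_hw sc I T i j \<xi> "g * F" 1
    unfolding T_def using twist_rtt_hw[OF g0] by (simp only: gG)
  obtain h D where h: "h $ 0 = 1" "\<And>N. N > D \<Longrightarrow> h $ N = 0" "\<And>N. N > D \<Longrightarrow> twist sc h T j i N \<xi> = 0"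
    using T.exists_denominator[OF refl fin] by blast
  define U where "U = twist sc h T"
  interpret U: rtt_hw sc I U i j \<xi> "h * (g * F)" h
    unfolding U_def using T.twist_rtt_hw[OF h(1)] by simp
  \<comment> \<open>The difference of the two eigenvalues is read off from
    \<open>e (U j i N \<xi>)\<close>, so if the series \<open>h\<close> and \<open>c(u)\<xi>\<close>
    stop at \<open>D\<close>, so does the third.\<close>
  have beyond: "(h * (g * F)) $ N = 0" if "N > D" for N
  proof -
    have "U j i N \<xi> = 0"
      using h(3)[OF that] by (simp add: U_def)
    then show ?thesis
      using U.e_c_\<xi>[of N] h(2)[OF that] \<xi>_nonzero I by (simp add: U.S_zero)
  qed
  interpret U: rtt_poly sc I U i j \<xi> "h * (g * F)" h D
    by unfold_locales (use I_eq beyond h U_def in auto)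
  \<comment> \<open>Scalar series with constant term one do not change the first off-diagonal
    coefficient, so nilpotency of \<open>f\<close> carries over.\<close>
  have Uf: "U.f = f"
  proof
    fix x
    have "U.f x = T j i (Suc 0) x"
      unfolding U_def using I h(1) by (intro T.twist_1) auto
    also have "\<dots> = f x"
      unfolding T_def using I g0 by (intro twist_1) auto
    finally show "U.f x = f x" .
  qed
  have norms: "(\<Prod>t<p. \<Sum>N\<le>D. (h * (g * F)) $ N * (u - of_nat t) ^ (D - N))
      = (\<Prod>t<p. \<Sum>N\<le>D. h $ N * (u - of_nat t) ^ (D - N))" for u
    using nil by (intro U.norms_eq p) (simp_all only: Uf)
  obtain A where A: "lead_coeff A = 1" "degree A = D" "fps_of_poly (reflect_poly A) = h * (g * F)"
    using fps_eq_reflect_poly[OF U.F_0 beyond] by blast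
  obtain B where B: "lead_coeff B = 1" "degree B = D" "fps_of_poly (reflect_poly B) = h"
    using fps_eq_reflect_poly[OF h(1,2)] by blast
  have "poly (\<Prod>t<p. pcompose A [:- of_nat t, 1:]) u = poly (\<Prod>t<p. pcompose B [:- of_nat t, 1:]) u" for u
    using norms[of u] unfolding poly_prod poly_pcompose poly_eq_sum_reflect[of A] poly_eq_sum_reflect[of B] A(2,3) B(2,3)
    by simp
  then have "(\<Prod>t<p. pcompose A [:- of_nat t, 1:]) = (\<Prod>t<p. pcompose B [:- of_nat t, 1:])"
    using poly_eq_if_infinite infinite_UNIV_if_roots[OF closed] by blast
  then obtain P where P: "lead_coeff P = 1" "A * P = B * pcompose P [:1, 1:]"
    using shift_ratio_if_norms_eq[OF closed p(2,3) A(1) B(1)] by blast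
  have "h * (g * F) * fps_of_poly (reflect_poly P) = h * fps_of_poly (reflect_poly (pcompose P [:1, 1:]))"
    using arg_cong[OF P(2), of "\<lambda>Q. fps_of_poly (reflect_poly Q)"]
    by (simp only: reflect_poly_mult fps_of_poly_mult A(3) B(3))
  moreover have "h \<noteq> 0"
    using h(1) by auto
  ultimately have "g * F * fps_of_poly (reflect_poly P) = fps_of_poly (reflect_poly (pcompose P [:1, 1:]))"
    by (simp add: mult.assoc)
  then have "(g * G) * (F * fps_of_poly (reflect_poly P)) = G * fps_of_poly (reflect_poly (pcompose P [:1, 1:]))"
    by (simp add: ac_simps)
  then show ?thesis
    using P(1) gG by auto
qed

section \<open>Existence of Drinfeld polynomials\<close>

lemma yangian_rep_rtt_rep:
  assumes "yangian_rep sc n T"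
  shows "rtt_rep sc {1..n} (tgen T)"
proof (intro rtt_rep.intro rtt_rep_axioms.intro)
  show vs: "vector_space sc"
    using assms by (simp add: yangian_rep_def)
  fix i j assume ij: "i \<in> {1..n}" "j \<in> {1..n}"
  show "Vector_Spaces.linear sc sc (tgen T i j r)" for r
  proof (cases "r = 0")
    case True
    interpret vector_space sc by (rule vs)
    show ?thesis
      using True vs by (simp add: tgen_def Vector_Spaces.linear_iff)
  next
    case False
    then have "lin_on sc sc UNIV (T i j r)"
      using assms ij by (simp add: yangian_rep_def)
    then show ?thesis
      using False vs by (simp add: tgen_def Vector_Spaces.linear_iff lin_on_def)
  qed
  show "tgen T i j 0 x = (if i = j then x else 0)" for x
    by (simp add: tgen_def)
  fix k l r s x assume "k \<in> {1..n}" "l \<in> {1..n}"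
  then show "tgen T i j (Suc r) (tgen T k l s x) - tgen T k l s (tgen T i j (Suc r) x)
      - (tgen T i j r (tgen T k l (Suc s) x) - tgen T k l (Suc s) (tgen T i j r x))
      = tgen T k j r (tgen T i l s x) - tgen T k j s (tgen T i l r x)"
    using assms ij unfolding yangian_rep_def Suc_eq_plus1 by blast
qed

lemma yangian_rep_gl_rep:
  assumes "yangian_rep sc n T"
  shows "gl_rep sc n (\<lambda>a b. T a b 1)"
proof -
  interpret rtt_rep sc "{1..n}" "tgen T"
    using assms by (rule yangian_rep_rtt_rep)
  have T: "tgen T a b (Suc 0) = T a b 1" for a b
    by (simp add: tgen_def)
  show ?thesis
  proof (intro gl_rep.intro gl_rep_axioms.intro vector_space_axioms)
    fix a b assume ab: "a \<in> {1..n}" "b \<in> {1..n}"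
    show "Vector_Spaces.linear sc sc (T a b 1)"
      using lin[OF ab, of "Suc 0"] by (simp only: T)
    fix c d x assume "c \<in> {1..n}" "d \<in> {1..n}"
    from comm_1[OF ab this, of "Suc 0" x]
    show "T a b 1 (T c d 1 x) - T c d 1 (T a b 1 x)
      = (if b = c then T a d 1 x else 0) - (if d = a then T c b 1 x else 0)"
      unfolding T by auto
  qed
qed

theorem theorem3p2p5:
  fixes sc :: "'k::field \<Rightarrow> 'v::ab_group_add \<Rightarrow> 'v"
    and T :: "nat \<Rightarrow> nat \<Rightarrow> nat \<Rightarrow> 'v \<Rightarrow> 'v"
    and p n k :: nat
    and \<mu> :: "nat \<Rightarrow> nat \<Rightarrow> int"
    and W :: "nat \<Rightarrow> 'v set"
    and lam :: "nat \<Rightarrow> nat \<Rightarrow> 'k"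
  assumes "prime p"
    and "CHAR('k) = p"
    and "\<forall>P :: 'k poly. degree P \<ge> 1 \<longrightarrow> (\<exists>x. poly P x = 0)"
    and "\<forall>x :: 'k. \<exists>m\<ge>1. x ^ (p ^ m) = x"
    and "n \<ge> 1"
    and "yangian_rep sc n T"
    and "yangian_irreducible sc n T"
    and "\<forall>j<k. dominant n (\<mu> j)"
    and "\<forall>j<k. is_weyl_module sc n (\<lambda>a b. T a b 1) (W j) (\<mu> j)"
    and "\<forall>x. \<exists>!w. (\<forall>j<k. w j \<in> W j) \<and> (\<forall>j\<ge>k. w j = 0) \<and> x = (\<Sum>j<k. w j)"
    and "\<forall>j<k. int p > \<mu> j 1 - \<mu> j n + int n"
    and "\<forall>i\<in>{1..n}. lam i 0 = 1"
    and "yangian_highest_weight sc n T lam"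
  shows "\<exists>P :: nat \<Rightarrow> 'k poly. \<forall>i\<in>{1..<n}. lead_coeff (P i) = 1 \<and>
           Abs_fps (lam i) * fps_of_poly (reflect_poly (P i))
           = Abs_fps (lam (i+1)) * fps_of_poly (reflect_poly (pcompose (P i) [:1, 1:]))"
proof -
  let ?E = "\<lambda>a b. T a b 1"
  note rep = assms(6)
  obtain \<xi> where \<xi>: "\<xi> \<noteq> 0"
      "\<And>i j r. \<lbrakk>i \<in> {1..n}; j \<in> {1..n}; r \<ge> 1; i < j\<rbrakk> \<Longrightarrow> T i j r \<xi> = 0"
      "\<And>i r. \<lbrakk>i \<in> {1..n}; r \<ge> 1\<rbrakk> \<Longrightarrow> T i i r \<xi> = sc (lam i r) \<xi>"
    using assms(13) unfolding yangian_highest_weight_def by blast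
  interpret Y: rtt_rep sc "{1..n}" "tgen T"
    using rep by (rule yangian_rep_rtt_rep)
  interpret gl: gl_rep sc n ?E
    using rep by (rule yangian_rep_gl_rep)
  have p: "p > 0" "of_nat p = (0 :: 'k)"
    using assms(1,2) of_nat_CHAR prime_gt_0_nat by blast+
  have char: "of_nat m \<noteq> (0 :: 'k)" if "0 < m" "m < p" for m
    using that assms(2) by (auto simp: of_nat_eq_0_iff_char_dvd dest: dvd_imp_le)
  have "\<exists>v. gl_hw sc n ?E (\<mu> j) v \<and> W j = cyclic_sub sc n ?E v" if j: "j < k" for j
  proof -
    have "is_weyl_module sc n ?E (W j) (\<mu> j)"
      using assms(9) j by blast
    then obtain v where v: "W j = cyclic_sub sc n ?E v" "weyl_rel sc n ?E (\<mu> j) v"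
      unfolding is_weyl_module_def by (elim conjE bexE) (rule that)
    have *: "dominant n (\<mu> j)" "int p > \<mu> j 1 - \<mu> j n + int n"
      using assms(8,11) j by blast+
    have "gl_hw sc n ?E (\<mu> j) v"
    proof (intro gl_hw.intro gl_hw_axioms.intro gl.gl_rep_axioms assms(5))
      \<comment> \<open>Since \<open>n \<ge> 1\<close>, the bound
        \<open>\<mu> j 1 - \<mu> j n + 1\<close> is still less than \<open>p\<close>.\<close>
      show "of_nat m \<noteq> (0 :: 'k)" if "0 < m" "int m \<le> \<mu> j 1 - \<mu> j n + 1" for m
        using that *(2) assms(5) by (intro char) linarith+
      show "\<mu> j (i + 1) \<le> \<mu> j i" if "i \<in> {1..<n}" for i
        using that *(1) by (simp add: dominant_def)
    qed (use v(2) in \<open>unfold weyl_rel_def, blast+\<close>)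
    then show ?thesis
      using v(1) by blast
  qed
  then obtain v where hw: "\<And>j. j < k \<Longrightarrow> gl_hw sc n ?E (\<mu> j) (v j)"
      and W: "\<And>j. j < k \<Longrightarrow> W j = cyclic_sub sc n ?E (v j)"
    by metis
  have decomp: "\<exists>w. (\<forall>j<k. w j \<in> W j) \<and> x = (\<Sum>j<k. w j)" for x
    using assms(10) by blast
  \<comment> \<open>Finite dimension of the whole module follows from finitely many lowering words
    in each of the \<open>k\<close> summands.\<close>
  have "\<exists>B. finite B \<and> W j \<subseteq> Y.span B" if "j < k" for j
    using gl_hw.finite_reachable[OF hw[OF that]] gl_hw.cyclic_sub_subset_span[OF hw[OF that]] W[OF that]
    by blast
  then obtain B where B: "\<And>j. j < k \<Longrightarrow> finite (B j)" "\<And>j. j < k \<Longrightarrow> W j \<subseteq> Y.span (B j)"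
    by metis
  have finB: "finite (\<Union>j<k. B j)"
    using B(1) by auto
  have spanB: "Y.span (\<Union>j<k. B j) = UNIV"
  proof -
    have "x \<in> Y.span (\<Union>j<k. B j)" for x
    proof -
      obtain w where w: "\<forall>j<k. w j \<in> W j" "x = (\<Sum>j<k. w j)"
        using decomp by blast
      have "w j \<in> Y.span (\<Union>j<k. B j)" if "j < k" for j
        using w(1) B(2)[OF that] Y.span_mono[of "B j" "\<Union>j<k. B j"] that by blast
      then show ?thesis
        unfolding w(2) by (intro Y.span_sum) auto
    qed
    then show ?thesis by blast
  qed
  have "\<exists>P. lead_coeff P = 1 \<and> Abs_fps (lam i) * fps_of_poly (reflect_poly P)
      = Abs_fps (lam (i+1)) * fps_of_poly (reflect_poly (pcompose P [:1, 1:]))"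
    if i: "i \<in> {1..<n}" for i
  proof -
    have in_n: "i \<in> {1..n}" "i + 1 \<in> {1..n}"
      using i by auto
    have nil: "(T (i + 1) i 1 ^^ (p - 1)) x = 0" for x
    proof -
      obtain w where w: "\<forall>j<k. w j \<in> W j" "x = (\<Sum>j<k. w j)"
        using decomp by blast
      have add: "(T (i + 1) i 1 ^^ m) (\<Sum>j\<in>J. w j) = (\<Sum>j\<in>J. (T (i + 1) i 1 ^^ m) (w j))" for m J
      proof (induction m)
        case (Suc m)
        show ?case
          using Y.S_sum[OF in_n(2,1), of "Suc 0" "\<lambda>j. (T (i + 1) i 1 ^^ m) (w j)" J]
          unfolding funpow.simps comp_apply Suc by (simp add: tgen_def)
      qed simp
      have "(T (i + 1) i 1 ^^ (p - 1)) (w j) = 0" if j: "j < k" for j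
      proof (rule gl_hw.lower_power_zero[OF hw[OF j] _ i])
        show "w j \<in> cyclic_sub sc n ?E (v j)"
          using w(1) W j by auto
        \<comment> \<open>The summand \<open>n \<ge> 1\<close> in the bound on \<open>p\<close>
          allows the exponent \<open>p - 1\<close> in place of \<open>p\<close>.\<close>
        show "int (p - 1) > \<mu> j 1 - \<mu> j n"
          using assms(11) j i by fastforce
      qed
      then show ?thesis
        unfolding w(2) add by simp
    qed
    have "tgen T a a r \<xi> = sc (Abs_fps (lam a) $ r) \<xi>" if "a \<in> {1..n}" for a r
      using \<xi>(3)[OF that] assms(12) that by (simp add: tgen_def)
    moreover have "tgen T i (i + 1) r \<xi> = 0" for r
      using \<xi>(2)[OF in_n] by (simp add: tgen_def)
    \<comment> \<open>Restricting to two indices matters because \<open>rtt_poly\<close> demands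
      that every current of the index set be polynomial on \<open>\<xi>\<close>.\<close>
    ultimately have "rtt_hw sc {i, i + 1} (tgen T) i (i + 1) \<xi> (Abs_fps (lam i)) (Abs_fps (lam (i + 1)))"
      using in_n \<xi>(1)
      by (intro rtt_hw.intro rtt_hw_axioms.intro Y.rtt_rep_subset) auto
    then show ?thesis
    proof (rule rtt_hw.drinfeld_polynomial[OF _ assms(3) char p(2,1) refl _ finB spanB])
      show "(tgen T (i + 1) i (Suc 0) ^^ (p - 1)) \<xi> = 0"
        using nil[of \<xi>] by (simp add: tgen_def)
    qed auto
  qed
  then show ?thesis
    by (intro bchoice) blast
qed

end
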